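(* Let $K$ be an algebraically closed field of arbitrary characteristic, let $\mathfrak{m}=\langle x_1,\ldots,x_n\rangle\subset K[[x_1,\ldots,x_n]]$ and let $0\neq f\in\mathfrak{m}$ be a power series. (a) $f$ is an isolated singularity, i.e. $\mu(f)<\infty$, if and only if $f$ is finitely right determined. (b) $R_f=K[[x_1,\ldots,x_n]]/\langle f\rangle$ is an isolated hypersurface singularity, i.e. $\tau(f)<\infty$, if and only if $f$ is finitely contact determined.
   Context: $\mu(f)=\dim_K K[[x_1,\ldots,x_n]]/\langle f_{x_1},\ldots,f_{x_n}\rangle$ and $\tau(f)=\dim_K K[[x_1,\ldots,x_n]]/\langle f,f_{x_1},\ldots,f_{x_n}\rangle$. Power series $f,g$ are right equivalent if $f=\varphi(g)$ for some $K$-algebra automorphism $\varphi$ of $K[[x_1,\ldots,x_n]]$; they are contact equivalent if $f=u\cdot\varphi(g)$ for some such $\varphi$ and some unit $u$. $f$ is right (respectively contact) $k$-determined if $f$ is right (respectively contact) equivalent to every $g$ with $f-g\in\mathfrak{m}^{k+1}$, and finitely right (respectively contact) determined if this holds for some positive integer $k$. *)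

theory Defs
  imports
    "HOL-Algebra.Algebraic_Closure_Type"
    "HOL-Algebra.Embedded_Algebras"
    "HOL-Algebra.Ideal_Product"
    "HOL-Algebra.QuotRing"
    "HOL-Library.Function_Algebras"
    "HOL-Library.Extended_Nat"
begin

section \<open>Formal power series in several variables\<close>

text \<open>
  A series in \<open>K[[x\<^sub>1, \<dots>, x\<^sub>n]]\<close> is given by its coefficients. The variables are indexed by a
  finite type \<open>'n\<close> with \<open>n = CARD('n)\<close> elements, and the monomial \<open>\<Prod>i. x\<^sub>i ^ m i\<close> is represented by
  its exponent vector \<open>m :: 'n \<Rightarrow> nat\<close>. Exponent vectors are added pointwise.
\<close>

typedef ('a, 'n) mfps = "UNIV :: (('n \<Rightarrow> nat) \<Rightarrow> 'a) set"
  morphisms mfps_nth Abs_mfps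
  by simp

lemma mfps_nth_Abs [simp]: "mfps_nth (Abs_mfps f) = f"
  by (simp add: Abs_mfps_inverse)

lemma mfps_eq_iff: "f = g \<longleftrightarrow> (\<forall>m. mfps_nth f m = mfps_nth g m)"
  by (metis ext mfps_nth_inject)

lemma mfps_eqI: "(\<And>m. mfps_nth f m = mfps_nth g m) \<Longrightarrow> f = g"
  by (simp add: mfps_eq_iff)

lemma finite_exponents_le:
  fixes m :: "'n :: finite \<Rightarrow> nat"
  shows "finite {a. a \<le> m}"
proof -
  have "finite (PiE (UNIV :: 'n set) (\<lambda>i. {..m i}))"
    by (intro finite_PiE) auto
  then show ?thesis
    by (rule rev_finite_subset) (auto simp: le_fun_def PiE_def)
qed

lemma finite_exponent_splits [simp]:
  fixes m :: "'n :: finite \<Rightarrow> nat"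
  shows "finite {(a, b). a + b = m}"
proof -
  have "{(a, b). a + b = m} \<subseteq> {a. a \<le> m} \<times> {a. a \<le> m}"
    by (auto simp: le_fun_def)
  then show ?thesis
    using finite_exponents_le[of m] by (meson finite_SigmaI finite_subset)
qed

instantiation mfps :: (comm_ring_1, finite) comm_ring_1
begin

definition "0 = Abs_mfps (\<lambda>_. 0)"
definition "1 = Abs_mfps (\<lambda>m. if m = 0 then 1 else 0)"
definition "f + g = Abs_mfps (\<lambda>m. mfps_nth f m + mfps_nth g m)"
definition "f - g = Abs_mfps (\<lambda>m. mfps_nth f m - mfps_nth g m)"
definition "- f = Abs_mfps (\<lambda>m. - mfps_nth f m)"
definition "f * g = Abs_mfps (\<lambda>m. \<Sum>(a, b) | a + b = m. mfps_nth f a * mfps_nth g b)"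

instance
proof
  fix f g h :: "('a, 'b) mfps"
  show "f + g + h = f + (g + h)" "f + g = g + f" "0 + f = f" "- f + f = 0" "f - g = f + - g"
    by (simp_all add: mfps_eq_iff plus_mfps_def minus_mfps_def uminus_mfps_def zero_mfps_def)
  show "(0 :: ('a, 'b) mfps) \<noteq> 1"
    by (auto simp: mfps_eq_iff zero_mfps_def one_mfps_def)
  show "(f + g) * h = f * h + g * h"
    by (simp add: mfps_eq_iff plus_mfps_def times_mfps_def distrib_right sum.distrib
        case_prod_unfold)
  show "f * g = g * f"
  proof (rule mfps_eqI)
    fix m
    show "mfps_nth (f * g) m = mfps_nth (g * f) m"
      unfolding times_mfps_def mfps_nth_Abs
      by (rule sum.reindex_bij_witness[of _ prod.swap prod.swap]) (auto simp: ac_simps)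
  qed
  show "1 * f = f"
  proof (rule mfps_eqI)
    fix m
    have "mfps_nth (1 * f) m =
        (\<Sum>(a, b) | a + b = m. if a = 0 then mfps_nth f b else 0)"
      by (auto simp: times_mfps_def one_mfps_def intro!: sum.cong)
    also have "\<dots> = (\<Sum>(a, b) \<in> {(0 :: 'b \<Rightarrow> nat, m)}. mfps_nth f b)"
      by (rule sum.mono_neutral_cong_right) (auto split: if_splits)
    finally show "mfps_nth (1 * f) m = mfps_nth f m"
      by simp
  qed
  show "f * g * h = f * (g * h)"
  proof (rule mfps_eqI)
    fix m
    let ?S = "\<lambda>m :: 'b \<Rightarrow> nat. {(a, b). a + b = m}"
    have "mfps_nth (f * g * h) m =
        (\<Sum>p \<in> ?S m. \<Sum>q \<in> ?S (fst p).
          mfps_nth f (fst q) * mfps_nth g (snd q) * mfps_nth h (snd p))"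
      by (simp add: times_mfps_def case_prod_unfold sum_distrib_right)
    also have "\<dots> = (\<Sum>(p, q) \<in> Sigma (?S m) (\<lambda>p. ?S (fst p)).
          mfps_nth f (fst q) * mfps_nth g (snd q) * mfps_nth h (snd p))"
      by (rule sum.Sigma) auto
    also have "\<dots> = (\<Sum>(p, q) \<in> Sigma (?S m) (\<lambda>p. ?S (snd p)).
          mfps_nth f (fst p) * (mfps_nth g (fst q) * mfps_nth h (snd q)))"
      by (rule sum.reindex_bij_witness
          [of _ "\<lambda>(p, q). ((fst p + fst q, snd q), (fst p, fst q))"
                "\<lambda>(p, q). ((fst q, snd q + snd p), (snd q, snd p))"])
        (auto simp: ac_simps)
    also have "\<dots> = (\<Sum>p \<in> ?S m. \<Sum>q \<in> ?S (snd p).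
          mfps_nth f (fst p) * (mfps_nth g (fst q) * mfps_nth h (snd q)))"
      by (rule sum.Sigma[symmetric]) auto
    also have "\<dots> = mfps_nth (f * (g * h)) m"
      by (simp add: times_mfps_def case_prod_unfold sum_distrib_left)
    finally show "mfps_nth (f * g * h) m = mfps_nth (f * (g * h)) m" .
  qed
qed

end

definition mfps_const :: "'a \<Rightarrow> ('a :: comm_ring_1, 'n :: finite) mfps" where
  "mfps_const c = Abs_mfps (\<lambda>m. if m = 0 then c else 0)"

definition mfps_X :: "'n \<Rightarrow> ('a :: comm_ring_1, 'n :: finite) mfps" where
  "mfps_X i = Abs_mfps (\<lambda>m. if m = 0(i := 1) then 1 else 0)"

definition mfps_deriv :: "'n \<Rightarrow> ('a :: comm_ring_1, 'n :: finite) mfps \<Rightarrow> ('a, 'n) mfps" where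
  "mfps_deriv i f = Abs_mfps (\<lambda>m. of_nat (Suc (m i)) * mfps_nth f (m(i := Suc (m i))))"

text \<open>The power series ring as an object of \<open>HOL-Algebra\<close>, for ideals and quotients.\<close>

abbreviation mfps_ring :: "('a :: comm_ring_1, 'n :: finite) mfps ring" where
  "mfps_ring \<equiv> ring_of_type_algebra"

definition mfps_max_ideal :: "('a :: comm_ring_1, 'n :: finite) mfps set" where
  "mfps_max_ideal = Idl\<^bsub>mfps_ring\<^esub> (range mfps_X)"


section \<open>Milnor and Tjurina numbers\<close>

text \<open>
  The dimension of \<open>K[[x]]/I\<close> over \<open>K\<close>, where \<open>K\<close> sits in the quotient as the classes of the constants.
  The case distinction is needed because the library's dimension is an unspecified natural number
  for infinite-dimensional spaces.
\<close>

definition mfps_quot_dim :: "('a :: field, 'n :: finite) mfps set \<Rightarrow> enat" where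
  "mfps_quot_dim I =
    (let Q = mfps_ring Quot I;
         K = range (\<lambda>c. I +>\<^bsub>mfps_ring\<^esub> mfps_const c)
     in if ring.finite_dimension Q K (carrier Q) then enat (ring.dim Q K (carrier Q)) else \<infinity>)"

definition milnor_number :: "('a :: field, 'n :: finite) mfps \<Rightarrow> enat" where
  "milnor_number f = mfps_quot_dim (Idl\<^bsub>mfps_ring\<^esub> (range (\<lambda>i. mfps_deriv i f)))"

definition tjurina_number :: "('a :: field, 'n :: finite) mfps \<Rightarrow> enat" where
  "tjurina_number f = mfps_quot_dim (Idl\<^bsub>mfps_ring\<^esub> (insert f (range (\<lambda>i. mfps_deriv i f))))"


section \<open>Equivalence and finite determinacy\<close>

definition mfps_automorphisms ::
    "(('a :: comm_ring_1, 'n :: finite) mfps \<Rightarrow> ('a, 'n) mfps) set" where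
  "mfps_automorphisms =
    {\<phi> \<in> ring_iso mfps_ring mfps_ring. \<forall>c. \<phi> (mfps_const c) = mfps_const c}"

definition right_equivalent ::
    "('a :: comm_ring_1, 'n :: finite) mfps \<Rightarrow> ('a, 'n) mfps \<Rightarrow> bool" where
  "right_equivalent f g \<longleftrightarrow> (\<exists>\<phi> \<in> mfps_automorphisms. f = \<phi> g)"

definition contact_equivalent ::
    "('a :: comm_ring_1, 'n :: finite) mfps \<Rightarrow> ('a, 'n) mfps \<Rightarrow> bool" where
  "contact_equivalent f g \<longleftrightarrow> (\<exists>\<phi> \<in> mfps_automorphisms. \<exists>u. u dvd 1 \<and> f = u * \<phi> g)"

text \<open>
  Powers of \<open>\<mm>\<close> are taken in the monoid of ideals under the ideal product.
\<close>

definition right_determined :: "nat \<Rightarrow> ('a :: comm_ring_1, 'n :: finite) mfps \<Rightarrow> bool" where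
  "right_determined k f \<longleftrightarrow>
    (\<forall>g. f - g \<in> mfps_max_ideal [^]\<^bsub>ideals_set mfps_ring\<^esub> (k + 1) \<longrightarrow> right_equivalent f g)"

definition contact_determined :: "nat \<Rightarrow> ('a :: comm_ring_1, 'n :: finite) mfps \<Rightarrow> bool" where
  "contact_determined k f \<longleftrightarrow>
    (\<forall>g. f - g \<in> mfps_max_ideal [^]\<^bsub>ideals_set mfps_ring\<^esub> (k + 1) \<longrightarrow> contact_equivalent f g)"

definition finitely_right_determined :: "('a :: comm_ring_1, 'n :: finite) mfps \<Rightarrow> bool" where
  "finitely_right_determined f \<longleftrightarrow> (\<exists>k>0. right_determined k f)"

definition finitely_contact_determined :: "('a :: comm_ring_1, 'n :: finite) mfps \<Rightarrow> bool" where
  "finitely_contact_determined f \<longleftrightarrow> (\<exists>k>0. contact_determined k f)"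

end

theory Submission
  imports Defs
begin

text \<open>
  Let \<open>T f\<close> be the ideal generated by the partial derivatives of \<open>f\<close> (and by \<open>f\<close> itself in the contact
  case). Its quotient is finite-dimensional if and only if \<open>\<mm>\<^sup>j \<subseteq> T f\<close> for some \<open>j\<close>: in a
  finite-dimensional quotient the powers of each variable are linearly dependent, and a nonzero
  polynomial in \<open>x\<^sub>i\<close> is a unit times a power of \<open>x\<^sub>i\<close>. This condition is invariant under the
  equivalence relation at hand.

  If \<open>\<mm>\<^sup>j \<subseteq> T f\<close> and \<open>f - g\<close> has order greater than \<open>2j\<close>, then the coefficients of \<open>f - g\<close> with respect to
  the generators of \<open>T f\<close> define a coordinate change (and a unit) that increases the order of the
  difference. Iterating and passing to the limit shows that \<open>f\<close> and \<open>g\<close> are equivalent.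

  Conversely, let \<open>f\<close> be \<open>k\<close>-determined. The tangent space of the orbit is of no use in positive
  characteristic, but \<open>f\<close> is equivalent to its \<open>k\<close>-jet plus \<open>\<Sum>i. x\<^sub>i\<^sup>N\<close> for any \<open>N > k + 1\<close> that is
  nonzero in the field. The leading forms of the derivatives of this polynomial are multiples of
  \<open>x\<^sub>i\<^sup>N\<^sup>-\<^sup>1\<close>, so it is an isolated singularity, and hence so is \<open>f\<close>.
\<close>

section \<open>Coefficients and monomials\<close>

lemmas mfps_defs = zero_mfps_def one_mfps_def plus_mfps_def minus_mfps_def uminus_mfps_def
  mfps_const_def mfps_X_def mfps_deriv_def

lemma mfps_nth_simps [simp]:
  "mfps_nth 0 m = 0" "mfps_nth (f + g) m = mfps_nth f m + mfps_nth g m"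
  "mfps_nth (f - g) m = mfps_nth f m - mfps_nth g m" "mfps_nth (- f) m = - mfps_nth f m"
  "mfps_nth 1 m = (if m = 0 then 1 else 0)"
  "mfps_nth (mfps_const c) m = (if m = 0 then c else 0)"
  by (simp_all add: mfps_defs)

lemma mfps_nth_deriv:
  "mfps_nth (mfps_deriv i f) m = of_nat (Suc (m i)) * mfps_nth f (m(i := Suc (m i)))"
  by (simp add: mfps_deriv_def)

lemma mfps_nth_mult:
  "mfps_nth (f * g) m = (\<Sum>(a, b) | a + b = m. mfps_nth f a * mfps_nth g b)"
  by (simp add: times_mfps_def)

lemma mfps_nth_sum: "mfps_nth (\<Sum>x\<in>A. F x) m = (\<Sum>x\<in>A. mfps_nth (F x) m)"
  by (induction A rule: infinite_finite_induct) auto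

definition mfps_monom :: "('n \<Rightarrow> nat) \<Rightarrow> ('a :: comm_ring_1, 'n :: finite) mfps" where
  "mfps_monom a = Abs_mfps (\<lambda>m. if m = a then 1 else 0)"

lemma mfps_nth_monom [simp]: "mfps_nth (mfps_monom a) m = (if m = a then 1 else 0)"
  by (simp add: mfps_monom_def)

lemma mfps_monom_0 [simp]: "mfps_monom 0 = 1"
  by (simp add: mfps_eq_iff)

lemma add_eq_iff_le_diff: "a + b = m \<longleftrightarrow> a \<le> m \<and> b = m - a"
  for m :: "'n \<Rightarrow> nat"
proof
  show "a \<le> m \<and> b = m - a" if "a + b = m"
    using that by (auto simp: le_fun_def)
  show "a + b = m" if "a \<le> m \<and> b = m - a"
    using that by (auto simp: le_fun_def fun_eq_iff)
qed

lemma mfps_X_eq_monom: "mfps_X i = mfps_monom (0(i := 1))"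
  by (simp add: mfps_X_def mfps_monom_def)

lemma mfps_nth_monom_mult:
  fixes a :: "'n :: finite \<Rightarrow> nat"
  shows "mfps_nth (mfps_monom a * h) m = (if a \<le> m then mfps_nth h (m - a) else 0)"
proof -
  have "mfps_nth (mfps_monom a * h) m = (\<Sum>(p, q) | p + q = m. if p = a then mfps_nth h q else 0)"
    unfolding mfps_nth_mult by (intro sum.cong) auto
  also have "\<dots> = (\<Sum>(p, q) \<in> (if a \<le> m then {(a, m - a)} else {}). mfps_nth h q)"
    by (rule sum.mono_neutral_cong_right[OF finite_exponent_splits])
      (auto simp: add_eq_iff_le_diff split: if_splits)
  finally show ?thesis by simp
qed

lemma mfps_monom_mult: "mfps_monom a * mfps_monom b = (mfps_monom (a + b) :: ('a :: comm_ring_1, 'n :: finite) mfps)"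
proof (rule mfps_eqI)
  fix m
  show "mfps_nth (mfps_monom a * mfps_monom b :: ('a, 'n) mfps) m =
      mfps_nth (mfps_monom (a + b)) m"
    using add_eq_iff_le_diff[of a b m] by (auto simp: mfps_nth_monom_mult )
qed

lemma mfps_nth_const_mult [simp]:
  fixes h :: "('a :: comm_ring_1, 'n :: finite) mfps"
  shows "mfps_nth (mfps_const c * h) m = c * mfps_nth h m"
proof -
  have "mfps_nth (mfps_const c * h) m = (\<Sum>(p, q) | p + q = m. if p = 0 then c * mfps_nth h q else 0)"
    unfolding mfps_nth_mult by (intro sum.cong) auto
  also have "\<dots> = (\<Sum>(p, q) \<in> {(0 :: 'n \<Rightarrow> nat, m)}. c * mfps_nth h q)"
    by (rule sum.mono_neutral_cong_right[OF finite_exponent_splits]) (auto split: if_splits)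
  finally show ?thesis by simp
qed

lemma mfps_const_simps:
  "mfps_const 0 = 0" "mfps_const 1 = 1"
  "mfps_const (a + b) = mfps_const a + mfps_const b"
  "mfps_const (a * b) = mfps_const a * mfps_const b"
  by (auto simp: mfps_eq_iff)

lemma mfps_nth_mult_0 [simp]: "mfps_nth (f * g) 0 = mfps_nth f 0 * mfps_nth g 0"
proof -
  have "{(a, b). a + b = (0 :: 'b \<Rightarrow> nat)} = {(0, 0)}"
    by (auto simp: fun_eq_iff)
  then show ?thesis by (simp add: mfps_nth_mult)
qed

section \<open>The order filtration\<close>

definition mdeg :: "('n :: finite \<Rightarrow> nat) \<Rightarrow> nat" where
  "mdeg m = (\<Sum>i\<in>UNIV. m i)"

lemma mdeg_add: "mdeg (a + b) = mdeg a + mdeg b"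
  by (simp add: mdeg_def sum.distrib)

lemma mdeg_0 [simp]: "mdeg 0 = 0" and mdeg_eq_0_iff [simp]: "mdeg m = 0 \<longleftrightarrow> m = 0"
  by (auto simp: mdeg_def fun_eq_iff)

lemma mdeg_single [simp]: "mdeg (0(i := e)) = e"
  by (simp add: mdeg_def fun_upd_def if_distrib sum.If_cases)

lemma upd_Suc_eq: "m(i := Suc (m i)) = m + 0(i := 1)"
  by (auto simp: fun_eq_iff)

lemma single_le_iff: "0(i := e) \<le> m \<longleftrightarrow> e \<le> m i" for m :: "'n \<Rightarrow> nat"
  by (auto simp: le_fun_def)

text \<open>The \<open>k\<close>-th power of the maximal ideal, encoded as the series of order at
  least \<open>k\<close>; \<open>mfps_max_ideal_pow\<close> proves the agreement.\<close>

definition mpow :: "nat \<Rightarrow> ('a :: comm_ring_1, 'n :: finite) mfps set" where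
  "mpow k = {h. \<forall>m. mdeg m < k \<longrightarrow> mfps_nth h m = 0}"

lemma mpowI: "(\<And>m. mdeg m < k \<Longrightarrow> mfps_nth h m = 0) \<Longrightarrow> h \<in> mpow k"
  by (simp add: mpow_def)

lemma mpowD: "h \<in> mpow k \<Longrightarrow> mdeg m < k \<Longrightarrow> mfps_nth h m = 0"
  by (simp add: mpow_def)

lemma mpow_UNIV [simp]: "h \<in> mpow 0"
  by (simp add: mpow_def)

lemma mpow_1_iff: "h \<in> mpow 1 \<longleftrightarrow> mfps_nth h 0 = 0"
  by (auto simp: mpow_def)

lemma mpow_zero [simp]: "0 \<in> mpow k"
  by (simp add: mpow_def)

lemma mpow_add: "a \<in> mpow k \<Longrightarrow> b \<in> mpow k \<Longrightarrow> a + b \<in> mpow k"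
  and mpow_diff: "a \<in> mpow k \<Longrightarrow> b \<in> mpow k \<Longrightarrow> a - b \<in> mpow k"
  and mpow_uminus: "a \<in> mpow k \<Longrightarrow> - a \<in> mpow k"
  by (auto simp: mpow_def)

lemma mpow_sum: "(\<And>x. x \<in> A \<Longrightarrow> F x \<in> mpow k) \<Longrightarrow> (\<Sum>x\<in>A. F x) \<in> mpow k"
  by (induction A rule: infinite_finite_induct) (auto intro: mpow_add)

lemma mpow_antimono: "h \<in> mpow l \<Longrightarrow> k \<le> l \<Longrightarrow> h \<in> mpow k"
  by (auto simp: mpow_def)

lemma mpow_mult:
  assumes "a \<in> mpow k" "b \<in> mpow l"
  shows "a * b \<in> mpow (k + l)"
proof (rule mpowI)
  fix m :: "'b \<Rightarrow> nat"
  assume m: "mdeg m < k + l"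
  show "mfps_nth (a * b) m = 0"
    unfolding mfps_nth_mult
  proof (intro sum.neutral ballI)
    fix x assume "x \<in> {(p, q). p + q = m}"
    then obtain p q where x: "x = (p, q)" "p + q = m" by auto
    then have "mdeg p < k \<or> mdeg q < l"
      using m mdeg_add[of p q] by (metis add_mono not_less)
    then show "(case x of (p, q) \<Rightarrow> mfps_nth a p * mfps_nth b q) = 0"
      using assms x by (auto dest: mpowD)
  qed
qed

lemma mpow_mult1: "b \<in> mpow l \<Longrightarrow> a * b \<in> mpow l"
  using mpow_mult[of a 0 b l] by simp

lemma mpow_mult2: "b \<in> mpow l \<Longrightarrow> b * a \<in> mpow l"
  using mpow_mult1[of b l a] by (simp add: mult.commute)

lemma mfps_monom_mem_mpow: "mfps_monom a \<in> mpow (mdeg a)"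
  by (auto intro: mpowI)

lemma mfps_X_mem_mpow: "mfps_X i \<in> mpow 1"
  using mfps_monom_mem_mpow[of "0(i := 1)"] by (simp only: mfps_X_eq_monom mdeg_single)

lemma mpow_Inter: "(\<And>k. h \<in> mpow k) \<Longrightarrow> h = 0"
  by (rule mfps_eqI) (metis mfps_nth_simps(1) lessI mpowD)

text \<open>Every monomial is assigned to one of the variables that divide it.\<close>

lemma mpow_Suc_decomp:
  fixes h :: "('a :: comm_ring_1, 'n :: finite) mfps"
  assumes "h \<in> mpow (Suc k)"
  obtains H where "h = (\<Sum>i\<in>UNIV. mfps_X i * H i)" "\<And>i. H i \<in> mpow k"
proof -
  define p :: "('n \<Rightarrow> nat) \<Rightarrow> 'n" where "p = (\<lambda>m. SOME i. m i > 0)"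
  define H :: "'n \<Rightarrow> ('a, 'n) mfps" where
    "H = (\<lambda>i. Abs_mfps (\<lambda>m. if p (m + 0(i := 1)) = i then mfps_nth h (m + 0(i := 1)) else 0))"
  have p: "m (p m) > 0" if "m \<noteq> 0" for m
    using that unfolding p_def by (intro someI_ex[of "\<lambda>i. m i > 0"]) (auto simp: fun_eq_iff)
  have "mfps_nth h m = mfps_nth (\<Sum>i\<in>UNIV. mfps_X i * H i) m" for m
  proof (cases "m = 0")
    case True
    moreover have "mfps_nth (mfps_X i :: ('a, 'n) mfps) 0 = 0" for i
      using mfps_X_mem_mpow mpow_1_iff by blast
    ultimately show ?thesis
      using assms by (simp add: mfps_nth_sum mpowD)
  next
    case False
    have "mfps_nth (mfps_X i * H i) m = (if i = p m then mfps_nth h m else 0)" for i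
    proof (cases "m i \<ge> 1")
      case True
      define e where "e = (0(i := 1) :: 'n \<Rightarrow> nat)"
      have "m - e + e = m"
        using True by (auto simp: fun_eq_iff e_def)
      moreover have "e \<le> m"
        unfolding e_def using True by (simp only: single_le_iff)
      ultimately have "mfps_nth (mfps_X i * H i) m = (if p m = i then mfps_nth h m else 0)"
        unfolding mfps_X_eq_monom mfps_nth_monom_mult H_def mfps_nth_Abs e_def[symmetric]
        by (simp only: if_True)
      then show ?thesis by (simp only: eq_commute[of i])
    next
      case False
      then show ?thesis
        using p[OF \<open>m \<noteq> 0\<close>] unfolding mfps_X_eq_monom mfps_nth_monom_mult single_le_iff
        by (cases "i = p m") simp_all
    qed
    then have "mfps_nth (\<Sum>i\<in>UNIV. mfps_X i * H i) m =
        (\<Sum>i\<in>UNIV. if i = p m then mfps_nth h m else 0)"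
      by (simp add: mfps_nth_sum)
    then show ?thesis by simp
  qed
  moreover have "H i \<in> mpow k" for i
  proof (rule mpowI)
    fix m :: "'n \<Rightarrow> nat"
    assume "mdeg m < k"
    then have "mdeg (m + 0(i := 1)) < Suc k"
      by (simp only: mdeg_add mdeg_single)
    from mpowD[OF assms this] show "mfps_nth (H i) m = 0"
      by (simp only: H_def mfps_nth_Abs if_cancel)
  qed
  ultimately show thesis
    using that by (auto simp: mfps_eq_iff)
qed

lemma mfps_decomp:
  fixes h :: "('a :: comm_ring_1, 'n :: finite) mfps"
  obtains c H where "h = mfps_const c + (\<Sum>i\<in>UNIV. mfps_X i * H i)"
proof -
  have "h - mfps_const (mfps_nth h 0) \<in> mpow (Suc 0)"
    using mpow_1_iff by fastforce
  then show thesis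
    by (rule mpow_Suc_decomp) (use that in \<open>metis add.commute diff_add_cancel\<close>)
qed

section \<open>Completeness and units\<close>

lemma mfps_limit:
  assumes "\<And>s. h (Suc s) - h s \<in> mpow (d + s)"
  obtains l where "\<And>s. l - h s \<in> mpow (d + s)"
proof
  \<comment> \<open>The coefficient at \<open>m\<close> no longer changes from stage
    \<open>Suc (mdeg m)\<close> on, even if \<open>d = 0\<close>, so it is read off there.\<close>
  define l where "l = Abs_mfps (\<lambda>m. mfps_nth (h (Suc (mdeg m))) m)"
  have diff: "h (s + t) - h s \<in> mpow (d + s)" for s t
  proof (induction t)
    case (Suc t)
    have "h (s + Suc t) - h s = (h (Suc (s + t)) - h (s + t)) + (h (s + t) - h s)"
      by simp
    with Suc assms[of "s + t"] show ?case
      by (metis mpow_add mpow_antimono add_left_mono le_add1)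
  qed simp
  show "l - h s \<in> mpow (d + s)" for s
  proof (rule mpowI)
    fix m :: "'b \<Rightarrow> nat"
    assume m: "mdeg m < d + s"
    show "mfps_nth (l - h s) m = 0"
    proof (cases "s \<le> Suc (mdeg m)")
      case True
      then show ?thesis
        using mpowD[OF diff[of s "Suc (mdeg m) - s"] m] by (simp add: l_def)
    next
      case False
      then show ?thesis
        using mpowD[OF diff[of "Suc (mdeg m)" "s - Suc (mdeg m)"], of m] by (simp add: l_def)
    qed
  qed
qed

text \<open>Geometric series: \<open>h ^ s\<close> has order at least \<open>s\<close>, so the
  partial sums converge and the error \<open>h ^ s\<close> disappears in the limit.\<close>

lemma mfps_unit_one_minus:
  fixes h :: "('a :: comm_ring_1, 'n :: finite) mfps"
  assumes "h \<in> mpow 1"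
  shows "1 - h dvd 1"
proof -
  have pw: "h ^ s \<in> mpow s" for s
    by (induction s) (use assms mpow_mult[of h 1] in auto)
  obtain l where l: "\<And>s. l - (\<Sum>i<s. h ^ i) \<in> mpow (0 + s)"
    by (rule mfps_limit[of "\<lambda>s. \<Sum>i<s. h ^ i" 0]) (use pw in auto)
  have "(1 - h) * l - 1 \<in> mpow s" for s
  proof -
    have "(1 - h) * (\<Sum>i<s. h ^ i) = 1 - h ^ s"
      by (rule one_diff_power_eq[symmetric])
    then have "(1 - h) * l - 1 = (1 - h) * (l - (\<Sum>i<s. h ^ i)) - h ^ s"
      unfolding right_diff_distrib[of "1 - h"] by simp
    then show ?thesis
      using l[of s] pw[of s] by (auto intro!: mpow_diff mpow_mult1)
  qed
  then have "(1 - h) * l = 1"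
    using mpow_Inter[of "(1 - h) * l - 1"] by simp
  then show ?thesis by (metis dvd_triv_left)
qed

text \<open>The ring is local with maximal ideal \<open>mpow 1\<close>: scaling a nonzero constant
  coefficient to 1 reduces to the geometric series.\<close>

lemma mfps_unit_iff:
  fixes u :: "('a :: field, 'n :: finite) mfps"
  shows "u dvd 1 \<longleftrightarrow> u \<notin> mpow 1"
proof
  assume "u dvd 1"
  then obtain v where "u * v = 1" by (metis dvdE)
  then have "mfps_nth u 0 * mfps_nth v 0 = 1"
    by (metis mfps_nth_mult_0 mfps_nth_simps(5))
  then show "u \<notin> mpow 1" unfolding mpow_1_iff by auto
next
  assume "u \<notin> mpow 1"
  define c where "c = mfps_nth u 0"
  have c: "c \<noteq> 0" using \<open>u \<notin> mpow 1\<close> unfolding mpow_1_iff c_def .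
  define h where "h = 1 - mfps_const (inverse c) * u"
  have "h \<in> mpow 1" unfolding mpow_1_iff h_def using c by (simp add: c_def)
  then have "mfps_const (inverse c) * u dvd 1"
    using mfps_unit_one_minus[of h] by (simp add: h_def)
  then show "u dvd 1" by (rule dvd_mult_right)
qed

section \<open>Derivatives\<close>

lemma mfps_deriv_add: "mfps_deriv i (f + g) = mfps_deriv i f + mfps_deriv i g"
  and mfps_deriv_const [simp]: "mfps_deriv i (mfps_const c) = 0"
  by (auto simp: mfps_eq_iff mfps_nth_deriv algebra_simps fun_eq_iff)

lemma mfps_deriv_monom:
  "mfps_deriv i (mfps_monom a) = mfps_const (of_nat (a i)) * mfps_monom (a - 0(i := 1))"
proof (rule mfps_eqI)
  fix m
  show "mfps_nth (mfps_deriv i (mfps_monom a)) m =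
      mfps_nth (mfps_const (of_nat (a i)) * mfps_monom (a - 0(i := 1))) m"
    by (cases "a i") (auto simp: mfps_nth_deriv fun_eq_iff)
qed

lemma mfps_deriv_X:
  "mfps_deriv i (mfps_X j :: ('a :: comm_ring_1, 'b :: finite) mfps) = (if i = j then 1 else 0)"
proof -
  have "0(j := 1) - 0(j := 1) = (0 :: 'b \<Rightarrow> nat)" by simp
  then show ?thesis
    by (simp add: mfps_X_eq_monom mfps_deriv_monom mfps_const_simps)
qed

text \<open>In the coefficient at \<open>m\<close>, the weight \<open>m i + 1\<close> splits into
  \<open>a i + b i\<close> over all pairs with \<open>a + b = m(i := Suc (m i))\<close>; the two
  halves are the two products.\<close>

lemma mfps_deriv_mult:
  fixes f g :: "('a :: comm_ring_1, 'n :: finite) mfps"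
  shows "mfps_deriv i (f * g) = mfps_deriv i f * g + f * mfps_deriv i g"
proof -
  \<comment> \<open>Terms with \<open>a i = 0\<close> have weight 0; in the others \<open>a\<close>
    is lowered by one at \<open>i\<close>, which produces the coefficients of the
    derivative.\<close>
  have aux: "(\<Sum>(a, b) | a + b = m(i := Suc (m i)). of_nat (a i) * mfps_nth f a * mfps_nth g b) =
      mfps_nth (mfps_deriv i f * g) m" for f g :: "('a, 'n) mfps" and m
  proof -
    define e where "e = (0(i := 1) :: 'n \<Rightarrow> nat)"
    have e_i: "e i = 1" by (simp add: e_def)
    have e_cancel: "e + (a - e) = a" if "a i > 0" for a
      using that by (auto simp: e_def fun_eq_iff)
    have e_shift: "a - e + b = m" if "a i > 0" "a + b = m + e" for a b
    proof -
      have "(a - e + b) + e = m + e"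
        using e_cancel[of a, OF that(1)] that(2) by (metis add.assoc add.commute)
      then show ?thesis by (rule add_right_imp_eq)
    qed
    have "mfps_nth (mfps_deriv i f * g) m = (\<Sum>(a, b) | a + b = m.
        of_nat ((a + e) i) * mfps_nth f (a + e) * mfps_nth g b)"
      by (simp add: mfps_nth_mult mfps_nth_deriv upd_Suc_eq e_def)
    also have "\<dots> = (\<Sum>(a, b) | a + b = m + e \<and> a i > 0.
        of_nat (a i) * mfps_nth f a * mfps_nth g b)"
      by (rule sum.reindex_bij_witness[of _ "\<lambda>(a, b). (a - e, b)" "\<lambda>(a, b). (a + e, b)"])
        (auto simp: e_cancel e_shift e_i add.assoc add.commute[of _ e])
    also have "\<dots> = (\<Sum>(a, b) | a + b = m + e. of_nat (a i) * mfps_nth f a * mfps_nth g b)"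
      by (rule sum.mono_neutral_left) (auto intro!: gr0I)
    finally show ?thesis unfolding upd_Suc_eq e_def[symmetric] ..
  qed
  show ?thesis
  proof (rule mfps_eqI)
    fix m
    let ?n = "m(i := Suc (m i))"
    have "mfps_nth (mfps_deriv i (f * g)) m =
        (\<Sum>(a, b) | a + b = ?n. of_nat (?n i) * (mfps_nth f a * mfps_nth g b))"
      by (simp add: mfps_nth_deriv mfps_nth_mult sum_distrib_left case_prod_unfold)
    also have "\<dots> = (\<Sum>(a, b) | a + b = ?n. of_nat (a i) * mfps_nth f a * mfps_nth g b +
        of_nat (b i) * mfps_nth g b * mfps_nth f a)"
    proof (rule sum.cong)
      fix x assume "x \<in> {(a, b). a + b = ?n}"
      then obtain a b where x: "x = (a, b)" "a + b = ?n" by auto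
      then have "?n i = a i + b i" by (metis plus_fun_apply)
      then show "(case x of (a, b) \<Rightarrow> of_nat (?n i) * (mfps_nth f a * mfps_nth g b)) =
          (case x of (a, b) \<Rightarrow> of_nat (a i) * mfps_nth f a * mfps_nth g b +
            of_nat (b i) * mfps_nth g b * mfps_nth f a)"
        unfolding x(1) by (simp only: prod.case) (simp add: algebra_simps)
    qed simp
    also have "\<dots> = mfps_nth (mfps_deriv i f * g) m +
        (\<Sum>(a, b) | a + b = ?n. of_nat (b i) * mfps_nth g b * mfps_nth f a)"
      unfolding aux[symmetric] by (simp add: sum.distrib case_prod_unfold)
    also have "(\<Sum>(a, b) | a + b = ?n. of_nat (b i) * mfps_nth g b * mfps_nth f a) =
        (\<Sum>(a, b) | a + b = ?n. of_nat (a i) * mfps_nth g a * mfps_nth f b)"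
      by (rule sum.reindex_bij_witness[of _ prod.swap prod.swap]) (auto simp: add.commute)
    also have "\<dots> = mfps_nth (mfps_deriv i g * f) m"
      by (rule aux)
    finally show "mfps_nth (mfps_deriv i (f * g)) m =
        mfps_nth (mfps_deriv i f * g + f * mfps_deriv i g) m"
      by (simp add: mult.commute)
  qed
qed

lemma mfps_deriv_sum: "mfps_deriv i (\<Sum>x\<in>A. F x) = (\<Sum>x\<in>A. mfps_deriv i (F x))"
  by (induction A rule: infinite_finite_induct)
    (use mfps_deriv_const[of i 0] in \<open>auto simp: mfps_const_simps mfps_deriv_add\<close>)

lemma mfps_deriv_decomp:
  fixes H :: "'n :: finite \<Rightarrow> ('a :: comm_ring_1, 'n) mfps"
  shows "mfps_deriv j (mfps_const c + (\<Sum>i\<in>UNIV. mfps_X i * H i)) =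
    H j + (\<Sum>i\<in>UNIV. mfps_X i * mfps_deriv j (H i))"
proof -
  have "mfps_deriv j (mfps_const c + (\<Sum>i\<in>UNIV. mfps_X i * H i)) =
      (\<Sum>i\<in>UNIV. (if i = j then H i else 0) + mfps_X i * mfps_deriv j (H i))"
    unfolding mfps_deriv_add mfps_deriv_sum mfps_deriv_mult mfps_deriv_X mfps_deriv_const
    by (auto intro!: sum.cong)
  then show ?thesis by (simp add: sum.distrib)
qed

text \<open>Separates the part of a vector field that hits the explicit variables from the part that
  recurses into the \<open>H i\<close>. This is the induction step for both
  \<open>taylor_mem_mpow\<close> and \<open>mfps_derivation_eq\<close>.\<close>

lemma sum_deriv_decomp:
  fixes H :: "'n :: finite \<Rightarrow> ('a :: comm_ring_1, 'n) mfps"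
  assumes "h = mfps_const c + (\<Sum>i\<in>UNIV. mfps_X i * H i)"
  shows "(\<Sum>j\<in>UNIV. b j * mfps_deriv j h) =
    (\<Sum>i\<in>UNIV. b i * H i + mfps_X i * (\<Sum>j\<in>UNIV. b j * mfps_deriv j (H i)))"
proof -
  have "(\<Sum>j\<in>UNIV. b j * mfps_deriv j h) = (\<Sum>j\<in>UNIV. b j * H j) +
      (\<Sum>j\<in>UNIV. \<Sum>i\<in>UNIV. mfps_X i * (b j * mfps_deriv j (H i)))"
    by (simp add: assms mfps_deriv_decomp distrib_left sum.distrib sum_distrib_left mult.left_commute)
  also have "(\<Sum>j\<in>UNIV. \<Sum>i\<in>UNIV. mfps_X i * (b j * mfps_deriv j (H i))) =
      (\<Sum>i\<in>UNIV. mfps_X i * (\<Sum>j\<in>UNIV. b j * mfps_deriv j (H i)))"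
    by (subst sum.swap) (simp add: sum_distrib_left)
  finally show ?thesis by (simp add: sum.distrib)
qed

section \<open>Algebra endomorphisms\<close>

lemma mfps_eqI_mpow: "(\<And>s. x - y \<in> mpow s) \<Longrightarrow> x = y"
  using mpow_Inter[of "x - y"] by simp

lemma mpow_diff_trans: "x - y \<in> mpow k \<Longrightarrow> y - z \<in> mpow k \<Longrightarrow> x - z \<in> mpow k"
  using mpow_add[of "x - y" k "y - z"] by simp

lemma mpow_diff_sym: "x - y \<in> mpow k \<Longrightarrow> y - x \<in> mpow k"
  using mpow_uminus[of "x - y" k] by simp

lemma mpow_diff_add: "x - y \<in> mpow k \<Longrightarrow> x' - y' \<in> mpow k \<Longrightarrow> (x + x') - (y + y') \<in> mpow k"
  using mpow_add[of "x - y" k "x' - y'"] by (simp add: algebra_simps)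

lemma mpow_diff_mult:
  assumes "x - y \<in> mpow k" "x' - y' \<in> mpow k"
  shows "x * x' - y * y' \<in> mpow k"
proof -
  have "x * x' - y * y' = x * (x' - y') + (x - y) * y'"
    by (simp add: algebra_simps)
  also have "\<dots> \<in> mpow k"
    using assms by (intro mpow_add mpow_mult1[of "x' - y'"] mpow_mult2[of "x - y"])
  finally show ?thesis .
qed

locale mfps_alg_hom =
  fixes \<phi> :: "('a :: comm_ring_1, 'n :: finite) mfps \<Rightarrow> ('a, 'n) mfps"
  assumes add [simp]: "\<phi> (a + b) = \<phi> a + \<phi> b"
    and mult [simp]: "\<phi> (a * b) = \<phi> a * \<phi> b"
    and const [simp]: "\<phi> (mfps_const c) = mfps_const c"
begin

lemma one [simp]: "\<phi> 1 = 1"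
  using const[of 1] by (simp only: mfps_const_simps)

lemma zero [simp]: "\<phi> 0 = 0"
  using const[of 0] by (simp only: mfps_const_simps)

lemma diff [simp]: "\<phi> (a - b) = \<phi> a - \<phi> b"
  using add[of "a - b" b] by (simp add: algebra_simps del: add)

lemma sum: "\<phi> (\<Sum>x\<in>A. F x) = (\<Sum>x\<in>A. \<phi> (F x))"
  by (induction A rule: infinite_finite_induct) auto

lemma dvd_1: "u dvd 1 \<Longrightarrow> \<phi> u dvd 1"
  by (metis dvd_def mult one)

text \<open>Continuity for the order filtration, obtained algebraically: splitting off one variable
  at a time involves only finite sums.\<close>

lemma mpow_image:
  assumes "\<And>i. \<phi> (mfps_X i) \<in> mpow 1" "h \<in> mpow k"
  shows "\<phi> h \<in> mpow k"
  using assms(2)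
proof (induction k arbitrary: h)
  case (Suc k)
  obtain H where H: "h = (\<Sum>i\<in>UNIV. mfps_X i * H i)" "\<And>i. H i \<in> mpow k"
    using mpow_Suc_decomp[OF Suc.prems] by metis
  have "\<phi> h = (\<Sum>i\<in>UNIV. \<phi> (mfps_X i) * \<phi> (H i))"
    by (simp add: H(1) sum)
  moreover have "\<phi> (mfps_X i) * \<phi> (H i) \<in> mpow (Suc k)" for i
    using mpow_mult[OF assms(1) Suc.IH[OF H(2)]] by simp
  ultimately show ?case by (auto intro: mpow_sum)
qed simp

text \<open>
  Statements on \<open>\<phi> h - h\<close> for all \<open>h\<close> are proved by gaining one order at a time through
  \<open>h = c + \<Sum>i. x\<^sub>i * h\<^sub>i\<close>.
\<close>

lemma diff_id_decomp:
  assumes "h = mfps_const c + (\<Sum>i\<in>UNIV. mfps_X i * H i)"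
  shows "\<phi> h - h = (\<Sum>i\<in>UNIV. mfps_X i * (\<phi> (H i) - H i) + (\<phi> (mfps_X i) - mfps_X i) * \<phi> (H i))"
  by (simp add: assms sum sum_subtractf[symmetric] algebra_simps)

text \<open>In \<open>diff_id_decomp\<close> the first summand gains an order from the variable,
  while the second has order \<open>M\<close> from the start; hence the gain runs up to
  \<open>M\<close>.\<close>

lemma diff_id_mem_mpow:
  assumes "\<And>i. \<phi> (mfps_X i) - mfps_X i \<in> mpow M"
  shows "\<phi> h - h \<in> mpow M"
proof -
  have "\<phi> h - h \<in> mpow N" if "N \<le> M" for N
    using that
  proof (induction N arbitrary: h)
    case (Suc N)
    obtain c H where "h = mfps_const c + (\<Sum>i\<in>UNIV. mfps_X i * H i)"
      by (rule mfps_decomp)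
    then have "\<phi> h - h =
        (\<Sum>i\<in>UNIV. mfps_X i * (\<phi> (H i) - H i) + (\<phi> (mfps_X i) - mfps_X i) * \<phi> (H i))"
      by (rule diff_id_decomp)
    moreover have "mfps_X i * (\<phi> (H i) - H i) \<in> mpow (Suc N)" for i
      using mpow_mult[OF mfps_X_mem_mpow Suc.IH] Suc.prems by simp
    moreover have "(\<phi> (mfps_X i) - mfps_X i) * \<phi> (H i) \<in> mpow (Suc N)" for i
      using assms Suc.prems by (blast intro: mpow_mult2 mpow_antimono)
    ultimately show ?case by (auto intro!: mpow_sum mpow_add)
  qed simp
  then show ?thesis by blast
qed

text \<open>First-order Taylor formula with quadratic remainder. The proof divides by no integer, so
  it is valid in every characteristic: the remainder satisfies a recursion whose only new term is
  \<open>a i * (\<phi> (H i) - H i)\<close>, a product of two factors of order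
  \<open>M\<close>.\<close>

lemma taylor_mem_mpow:
  assumes a: "\<And>i. \<phi> (mfps_X i) = mfps_X i + a i" "\<And>i. a i \<in> mpow M"
  shows "\<phi> h - h - (\<Sum>j\<in>UNIV. a j * mfps_deriv j h) \<in> mpow (2 * M)"
proof -
  define E where "E h = \<phi> h - h - (\<Sum>j\<in>UNIV. a j * mfps_deriv j h)" for h
  have "E h \<in> mpow N" if "N \<le> 2 * M" for N
    using that
  proof (induction N arbitrary: h)
    case (Suc N)
    obtain c H where h: "h = mfps_const c + (\<Sum>i\<in>UNIV. mfps_X i * H i)"
      by (rule mfps_decomp)
    have "E h = (\<Sum>i\<in>UNIV. mfps_X i * (\<phi> (H i) - H i) + a i * \<phi> (H i)) -
        (\<Sum>i\<in>UNIV. a i * H i + mfps_X i * (\<Sum>j\<in>UNIV. a j * mfps_deriv j (H i)))"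
      unfolding E_def sum_deriv_decomp[OF h] diff_id_decomp[OF h] by (simp add: a(1))
    also have "\<dots> = (\<Sum>i\<in>UNIV. mfps_X i * E (H i) + a i * (\<phi> (H i) - H i))"
      unfolding sum_subtractf[symmetric] E_def
      by (intro sum.cong) (auto simp: algebra_simps)
    finally have E: "E h = \<dots>" .
    have "mfps_X i * E (H i) \<in> mpow (Suc N)" for i
      using mpow_mult[OF mfps_X_mem_mpow Suc.IH] Suc.prems by simp
    moreover have "a i * (\<phi> (H i) - H i) \<in> mpow (Suc N)" for i
    proof -
      have "\<phi> (H i) - H i \<in> mpow M"
        by (rule diff_id_mem_mpow) (simp add: a)
      from mpow_mult[OF a(2) this] show ?thesis
        using Suc.prems by (auto intro: mpow_antimono simp: mult_2)
    qed
    ultimately show ?case unfolding E by (auto intro!: mpow_sum mpow_add)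
  qed simp
  then show ?thesis unfolding E_def by blast
qed

text \<open>The map \<open>\<phi> h - h\<close> raises the order (fact \<open>up\<close>). So the
  difference of two series with equal image lies in every \<open>mpow N\<close>, and correcting
  \<open>h\<close> by \<open>g - \<phi> h\<close> converges to a preimage of
  \<open>g\<close>.\<close>

lemma bij_if_tangent_to_id:
  assumes X: "\<And>i. \<phi> (mfps_X i) - mfps_X i \<in> mpow 2"
  shows "bij \<phi>"
proof -
  have X1: "\<phi> (mfps_X i) \<in> mpow 1" for i
    using mpow_add[OF mpow_antimono[OF X, of 1 i] mfps_X_mem_mpow[of i]] by simp
  have up: "\<phi> h - h \<in> mpow (Suc N)" if "h \<in> mpow N" for h N
    using that
  proof (induction N arbitrary: h)
    case 0
    show ?case using diff_id_mem_mpow[OF X] by (rule mpow_antimono) simp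
  next
    case (Suc N)
    obtain H where H: "h = (\<Sum>i\<in>UNIV. mfps_X i * H i)" "\<And>i. H i \<in> mpow N"
      using mpow_Suc_decomp[OF Suc.prems] by metis
    have "h = mfps_const 0 + (\<Sum>i\<in>UNIV. mfps_X i * H i)"
      by (simp add: H(1) mfps_const_simps)
    then have "\<phi> h - h =
        (\<Sum>i\<in>UNIV. mfps_X i * (\<phi> (H i) - H i) + (\<phi> (mfps_X i) - mfps_X i) * \<phi> (H i))"
      by (rule diff_id_decomp)
    moreover have "mfps_X i * (\<phi> (H i) - H i) \<in> mpow (Suc (Suc N))" for i
      using mpow_mult[OF mfps_X_mem_mpow Suc.IH[OF H(2)]] by simp
    moreover have "(\<phi> (mfps_X i) - mfps_X i) * \<phi> (H i) \<in> mpow (Suc (Suc N))" for i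
      using mpow_mult[OF X mpow_image[OF X1 H(2)]] by simp
    ultimately show ?case by (auto intro!: mpow_sum mpow_add)
  qed
  have "inj \<phi>"
  proof (rule injI)
    fix x y assume "\<phi> x = \<phi> y"
    have "x - y \<in> mpow N" for N
    proof (induction N)
      case (Suc N)
      show ?case using mpow_uminus[OF up[OF Suc]] \<open>\<phi> x = \<phi> y\<close> by simp
    qed simp
    then show "x = y" by (rule mfps_eqI_mpow)
  qed
  moreover have "surj \<phi>"
  proof (rule surjI)
    fix g
    define h where "h = rec_nat 0 (\<lambda>_ h. h + (g - \<phi> h))"
    have h_Suc: "h (Suc s) = h s + (g - \<phi> (h s))" for s
      by (simp add: h_def)
    have gh: "g - \<phi> (h s) \<in> mpow s" for s
    proof (induction s)
      case (Suc s)
      have "g - \<phi> (h (Suc s)) = - (\<phi> (g - \<phi> (h s)) - (g - \<phi> (h s)))"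
        by (simp add: h_Suc)
      then show ?case using mpow_uminus[OF up[OF Suc]] by metis
    qed simp
    have "h (Suc s) - h s \<in> mpow (0 + s)" for s
      using gh[of s] by (simp add: h_Suc)
    then obtain l where l: "\<And>s. l - h s \<in> mpow (0 + s)"
      by (rule mfps_limit) blast
    have "\<phi> l - g \<in> mpow s" for s
    proof (rule mpow_diff_trans)
      show "\<phi> l - \<phi> (h s) \<in> mpow s"
        using mpow_image[OF X1 l[of s]] by simp
      show "\<phi> (h s) - g \<in> mpow s"
        using mpow_diff_sym[OF gh] .
    qed
    then have "\<phi> l = g" by (rule mfps_eqI_mpow)
    \<comment> \<open>\<open>surjI\<close> asks for a right inverse, which is supplied by
      choice.\<close>
    then show "\<phi> (SOME l. \<phi> l = g) = g" by (rule someI)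
  qed
  ultimately show ?thesis by (simp add: bij_def)
qed

end

lemma mfps_alg_hom_id: "mfps_alg_hom (\<lambda>h. h)"
  by unfold_locales auto

lemma mfps_alg_hom_comp:
  assumes "mfps_alg_hom \<phi>" "mfps_alg_hom \<psi>"
  shows "mfps_alg_hom (\<lambda>h. \<phi> (\<psi> h))"
proof -
  interpret \<phi>: mfps_alg_hom \<phi> by fact
  interpret \<psi>: mfps_alg_hom \<psi> by fact
  show ?thesis by unfold_locales auto
qed

text \<open>Each law holds for every \<open>\<Phi> s\<close>, so it holds for the pointwise limit up
  to order \<open>s\<close>, for all \<open>s\<close>.\<close>

lemma mfps_alg_hom_limit:
  assumes hom: "\<And>s. mfps_alg_hom (\<Phi> s)"
    and conv: "\<And>h s. \<Phi> (Suc s) h - \<Phi> s h \<in> mpow (d + s)"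
  obtains \<phi> where "mfps_alg_hom \<phi>" "\<And>h s. \<phi> h - \<Phi> s h \<in> mpow (d + s)"
proof -
  have "\<exists>l. \<forall>s. l - \<Phi> s h \<in> mpow (d + s)" for h
    by (rule mfps_limit[of "\<lambda>s. \<Phi> s h" d, OF conv]) blast
  then obtain \<phi> where \<phi>: "\<phi> h - \<Phi> s h \<in> mpow (d + s)" for h s by metis
  have \<phi>': "\<phi> h - \<Phi> s h \<in> mpow s" for h s
    using \<phi> by (rule mpow_antimono) simp
  have "mfps_alg_hom \<phi>"
  proof
    show "\<phi> (a + b) = \<phi> a + \<phi> b" for a b
    proof (rule mfps_eqI_mpow)
      fix s
      interpret mfps_alg_hom "\<Phi> s" by (rule hom)
      show "\<phi> (a + b) - (\<phi> a + \<phi> b) \<in> mpow s"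
        using mpow_diff_trans[OF \<phi>'[of "a + b"]] mpow_diff_sym[OF mpow_diff_add[OF \<phi>' \<phi>']] by simp
    qed
    show "\<phi> (a * b) = \<phi> a * \<phi> b" for a b
    proof (rule mfps_eqI_mpow)
      fix s
      interpret mfps_alg_hom "\<Phi> s" by (rule hom)
      show "\<phi> (a * b) - \<phi> a * \<phi> b \<in> mpow s"
        using mpow_diff_trans[OF \<phi>'[of "a * b"]] mpow_diff_sym[OF mpow_diff_mult[OF \<phi>' \<phi>']] by simp
    qed
    show "\<phi> (mfps_const c) = mfps_const c" for c
      by (rule mfps_eqI_mpow) (metis \<phi>' hom mfps_alg_hom.const)
  qed
  with \<phi> show thesis by (rule that[rotated])
qed

section \<open>Substitution\<close>

lemma finite_mdeg_less [simp]: "finite {m :: 'n :: finite \<Rightarrow> nat. mdeg m < k}"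
proof (rule finite_subset)
  show "{m :: 'n \<Rightarrow> nat. mdeg m < k} \<subseteq> {m. m \<le> (\<lambda>_. k)}"
  proof (safe, rule le_funI)
    fix m :: "'n \<Rightarrow> nat" and i
    assume "mdeg m < k"
    moreover have "m i \<le> mdeg m" unfolding mdeg_def by (rule member_le_sum) auto
    ultimately show "m i \<le> k" by simp
  qed
qed (rule finite_exponents_le)

text \<open>Substitution of \<open>z i\<close> for the variables. \<open>Z a\<close> is the image of
  the monomial \<open>a\<close> and has order at least \<open>mdeg a\<close>, so the truncations
  \<open>P s\<close> converge.\<close>

lemma ex_mfps_subst:
  fixes z :: "'n :: finite \<Rightarrow> ('a :: comm_ring_1, 'n) mfps"
  assumes z: "\<And>i. z i \<in> mpow 1"
  obtains \<phi> where "mfps_alg_hom \<phi>" "\<And>i. \<phi> (mfps_X i) = z i"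
proof -
  define Z where "Z a = (\<Prod>i\<in>UNIV. z i ^ a i)" for a
  define P where "P s h = (\<Sum>a | mdeg a < s. mfps_const (mfps_nth h a) * Z a)" for s h
  have Z_add: "Z (a + b) = Z a * Z b" for a b
    by (simp add: Z_def power_add prod.distrib)
  have Z_mpow: "Z a \<in> mpow k" if "k \<le> mdeg a" for a k
  proof -
    have pow: "z i ^ e \<in> mpow e" for i e
      by (induction e) (use mpow_mult[OF z] in auto)
    have "(\<Prod>i\<in>A. z i ^ a i) \<in> mpow (\<Sum>i\<in>A. a i)" for A
      by (induction A rule: infinite_finite_induct) (use mpow_mult[OF pow] in auto)
    then show ?thesis
      using that unfolding Z_def mdeg_def by (blast intro: mpow_antimono)
  qed
  have Z_0: "Z 0 = 1" by (simp add: Z_def)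
  have Z_single: "Z (0(i := 1)) = z i" for i
  proof -
    have "Z (0(i := 1)) = (\<Prod>j\<in>UNIV. if j = i then z j else 1)"
      unfolding Z_def by (intro prod.cong) auto
    then show ?thesis by simp
  qed
  have "\<exists>l. \<forall>s. l - P s h \<in> mpow (0 + s)" for h
  proof -
    have "P (Suc s) h - P s h \<in> mpow (0 + s)" for s
    proof -
      have "P (Suc s) h - P s h = (\<Sum>a\<in>{a. mdeg a < Suc s} - {a. mdeg a < s}. mfps_const (mfps_nth h a) * Z a)"
        unfolding P_def by (subst sum_diff) auto
      also have "\<dots> \<in> mpow s"
        by (intro mpow_sum mpow_mult1 Z_mpow) auto
      finally show ?thesis by simp
    qed
    from mfps_limit[of "\<lambda>s. P s h" 0, OF this] show ?thesis by metis
  qed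
  then obtain \<phi> where \<phi>: "\<phi> h - P s h \<in> mpow s" for h s by (metis add_0)
  have P_add: "P s (g + h) = P s g + P s h" for s g h
    by (simp add: P_def mfps_const_simps distrib_right sum.distrib)
  \<comment> \<open>Truncations are multiplicative only modulo order \<open>s\<close>: the error
    consists of pairs of monomials of degree below \<open>s\<close> whose product has degree at
    least \<open>s\<close>.\<close>
  have P_mult: "P s (g * h) - P s g * P s h \<in> mpow s" for s g h
  proof -
    define F where "F = (\<lambda>(a, b). mfps_const (mfps_nth g a * mfps_nth h b) * Z (a + b))"
    define D where "D = {a :: 'n \<Rightarrow> nat. mdeg a < s}"
    have const_sum: "mfps_const (\<Sum>x\<in>A. c x) = (\<Sum>x\<in>A. mfps_const (c x) :: ('a, 'n) mfps)"
      for A :: "(('n \<Rightarrow> nat) \<times> ('n \<Rightarrow> nat)) set" and c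
      by (induction A rule: infinite_finite_induct) (auto simp: mfps_const_simps)
    have "P s (g * h) = (\<Sum>m\<in>D. \<Sum>p | fst p + snd p = m. F p)"
      unfolding P_def mfps_nth_mult case_prod_unfold D_def const_sum sum_distrib_right
      by (intro sum.cong) (auto simp: F_def case_prod_unfold)
    also have "\<dots> = (\<Sum>(m, p)\<in>Sigma D (\<lambda>m. {p. fst p + snd p = m}). F p)"
      using finite_exponent_splits by (intro sum.Sigma) (auto simp: D_def case_prod_unfold)
    also have "\<dots> = (\<Sum>p\<in>{p. fst p + snd p \<in> D}. F p)"
      by (rule sum.reindex_bij_witness[of _ "\<lambda>p. (fst p + snd p, p)" snd]) auto
    finally have 1: "P s (g * h) = (\<Sum>p\<in>{p. fst p + snd p \<in> D}. F p)" .
    have 2: "P s g * P s h = (\<Sum>p\<in>D \<times> D. F p)"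
      unfolding P_def D_def[symmetric] sum_product sum.cartesian_product
      by (intro sum.cong) (auto simp: F_def Z_add mfps_const_simps algebra_simps)
    have "finite (D \<times> D)" by (simp add: D_def)
    moreover have "{p. fst p + snd p \<in> D} \<subseteq> D \<times> D"
      by (auto simp: D_def mdeg_add)
    ultimately have "P s g * P s h - P s (g * h) = (\<Sum>p\<in>D \<times> D - {p. fst p + snd p \<in> D}. F p)"
      unfolding 1 2 by (subst sum_diff) auto
    also have "\<dots> \<in> mpow s"
    proof (rule mpow_sum)
      fix p assume "p \<in> D \<times> D - {p. fst p + snd p \<in> D}"
      then have "s \<le> mdeg (fst p + snd p)" by (auto simp: D_def)
      then show "F p \<in> mpow s"
        unfolding F_def case_prod_unfold by (intro mpow_mult1 Z_mpow)
    qed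
    finally show ?thesis by (rule mpow_diff_sym)
  qed
  have "mfps_alg_hom \<phi>"
  proof
    show "\<phi> (a + b) = \<phi> a + \<phi> b" for a b
    proof (rule mfps_eqI_mpow)
      show "\<phi> (a + b) - (\<phi> a + \<phi> b) \<in> mpow s" for s
        using mpow_diff_trans[OF \<phi>[of "a + b"]] mpow_diff_sym[OF mpow_diff_add[OF \<phi> \<phi>]]
        by (simp add: P_add)
    qed
    show "\<phi> (a * b) = \<phi> a * \<phi> b" for a b
    proof (rule mfps_eqI_mpow)
      show "\<phi> (a * b) - \<phi> a * \<phi> b \<in> mpow s" for s
        using mpow_diff_trans[OF mpow_diff_trans[OF \<phi>[of "a * b"] P_mult]
          mpow_diff_sym[OF mpow_diff_mult[OF \<phi> \<phi>]]] .
    qed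
    show "\<phi> (mfps_const c) = mfps_const c" for c
    proof (rule mfps_eqI_mpow)
      fix s
      \<comment> \<open>\<open>P 0\<close> is an empty sum; the constant term is present from stage
        1 on.\<close>
      have "P (Suc s) (mfps_const c) = (\<Sum>a\<in>{0}. mfps_const c * Z a)"
        unfolding P_def by (intro sum.mono_neutral_cong_right) (auto simp: mfps_const_simps)
      then have "P (Suc s) (mfps_const c) = mfps_const c" by (simp add: Z_0)
      with \<phi>[of "mfps_const c" "Suc s"] show "\<phi> (mfps_const c) - mfps_const c \<in> mpow s"
        by (auto intro: mpow_antimono)
    qed
  qed
  moreover have "\<phi> (mfps_X i) = z i" for i
  proof (rule mfps_eqI_mpow)
    fix s
    \<comment> \<open>A variable has degree 1, so its term is present from stage 2 on.\<close>
    have "P (Suc (Suc s)) (mfps_X i) = (\<Sum>a\<in>{0(i := 1)}. Z a)"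
      unfolding P_def mfps_X_eq_monom mfps_nth_monom
      by (intro sum.mono_neutral_cong_right)
        (auto simp: mfps_const_simps simp del: fun_upd_apply One_nat_def)
    then have "P (Suc (Suc s)) (mfps_X i) = z i" using Z_single[of i] by simp
    with \<phi>[of "mfps_X i" "Suc (Suc s)"] show "\<phi> (mfps_X i) - z i \<in> mpow s"
      by (auto intro: mpow_antimono)
  qed
  ultimately show thesis by (rule that)
qed

section \<open>Automorphisms\<close>

lemma mfps_automorphisms_iff: "\<phi> \<in> mfps_automorphisms \<longleftrightarrow> mfps_alg_hom \<phi> \<and> bij \<phi>"
proof
  assume "\<phi> \<in> mfps_automorphisms"
  then show "mfps_alg_hom \<phi> \<and> bij \<phi>"
    by (auto simp: mfps_automorphisms_def ring_iso_def ring_hom_def ring_of_type_algebra_def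
        mfps_alg_hom_def)
next
  assume *: "mfps_alg_hom \<phi> \<and> bij \<phi>"
  then interpret mfps_alg_hom \<phi> by simp
  show "\<phi> \<in> mfps_automorphisms"
    using * by (auto simp: mfps_automorphisms_def ring_iso_def ring_hom_def ring_of_type_algebra_def)
qed

lemma mfps_alg_hom_inverse:
  assumes "mfps_alg_hom \<phi>" "bij \<phi>"
  obtains \<psi> where "mfps_alg_hom \<psi>" "bij \<psi>" "\<And>x. \<phi> (\<psi> x) = x" "\<And>x. \<psi> (\<phi> x) = x"
proof -
  interpret mfps_alg_hom \<phi> by fact
  define \<psi> where "\<psi> = Hilbert_Choice.inv \<phi>"
  have r: "\<phi> (\<psi> x) = x" for x
    using assms(2) by (simp add: \<psi>_def bij_is_surj surj_f_inv_f)
  have l: "\<psi> (\<phi> x) = x" for x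
    using assms(2) by (simp add: \<psi>_def bij_is_inj)
  have "mfps_alg_hom \<psi>"
  proof
    show "\<psi> (a + b) = \<psi> a + \<psi> b" for a b
      by (metis add l r)
    show "\<psi> (a * b) = \<psi> a * \<psi> b" for a b
      by (metis mult l r)
    show "\<psi> (mfps_const c) = mfps_const c" for c
      by (metis const l)
  qed
  moreover have "bij \<psi>"
    unfolding \<psi>_def using assms(2) by (rule bij_imp_bij_inv)
  ultimately show thesis using that l r by blast
qed

text \<open>An automorphism preserves units, hence the maximal ideal and the order filtration.\<close>

lemma mfps_automorphism_mpow:
  fixes \<phi> :: "('a :: field, 'n :: finite) mfps \<Rightarrow> ('a, 'n) mfps"
  assumes "mfps_alg_hom \<phi>" "bij \<phi>" "h \<in> mpow k"
  shows "\<phi> h \<in> mpow k"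
proof -
  interpret mfps_alg_hom \<phi> by fact
  obtain \<psi> where \<psi>: "mfps_alg_hom \<psi>" "\<And>x. \<psi> (\<phi> x) = x"
    using mfps_alg_hom_inverse[OF assms(1,2)] by metis
  interpret \<psi>: mfps_alg_hom \<psi> by fact
  have "\<phi> (mfps_X i) \<in> mpow 1" for i
  proof (rule ccontr)
    assume "\<phi> (mfps_X i) \<notin> mpow 1"
    then have "\<psi> (\<phi> (mfps_X i)) dvd 1"
      by (intro \<psi>.dvd_1) (simp only: mfps_unit_iff simp_thms)
    then show False
      unfolding \<psi>(2) mfps_unit_iff using mfps_X_mem_mpow by blast
  qed
  then show ?thesis by (rule mpow_image) fact
qed

section \<open>Ideals and quotients\<close>

text \<open>Lets ideals be handled with the type class operations; closure under negation comes from
  multiplication by \<open>- 1\<close>.\<close>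

lemma ideal_type_iff:
  "ideal I (ring_of_type_algebra :: 'a :: comm_ring_1 ring) \<longleftrightarrow>
    0 \<in> I \<and> (\<forall>a\<in>I. \<forall>b\<in>I. a + b \<in> I) \<and> (\<forall>a\<in>I. \<forall>r. r * a \<in> I)" (is "ideal I ?R \<longleftrightarrow> ?rhs")
proof
  assume "ideal I ?R"
  then interpret ideal I ?R .
  show ?rhs
    using additive_subgroup.zero_closed[OF is_additive_subgroup]
      additive_subgroup.a_closed[OF is_additive_subgroup] I_l_closed
    by (simp add: ring_of_type_algebra_def)
next
  assume I: ?rhs
  interpret cring ?R by (rule cring_from_type_algebra)
  have uminus: "- a \<in> I" if "a \<in> I" for a
    using I that by (metis mult_minus1)
  have inv: "a_inv ?R a = - a" for a
    by (rule minus_equality) (auto simp: ring_of_type_algebra_def)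
  show "ideal I ?R"
  proof (rule idealI)
    show "subgroup I (add_monoid ?R)"
      using I uminus inv unfolding a_inv_def
      by unfold_locales (auto simp: ring_of_type_algebra_def)
    show "ring ?R" by (rule ring_axioms)
  qed (use I in \<open>auto simp: ring_of_type_algebra_def mult.commute\<close>)
qed

lemma ideal_type_zero: "ideal I (ring_of_type_algebra :: 'a :: comm_ring_1 ring) \<Longrightarrow> 0 \<in> I"
  and ideal_type_add: "ideal I ring_of_type_algebra \<Longrightarrow> a \<in> I \<Longrightarrow> b \<in> I \<Longrightarrow> a + b \<in> I"
  and ideal_type_mult: "ideal I ring_of_type_algebra \<Longrightarrow> a \<in> I \<Longrightarrow> r * a \<in> I"
  for a b r :: "'a :: comm_ring_1"
  by (auto simp: ideal_type_iff)

lemma ideal_type_sum: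
  assumes "ideal I (ring_of_type_algebra :: 'a :: comm_ring_1 ring)" "\<And>x. x \<in> A \<Longrightarrow> F x \<in> I"
  shows "(\<Sum>x\<in>A. F x) \<in> I"
  using assms(2)
  by (induction A rule: infinite_finite_induct)
    (auto intro: ideal_type_zero[OF assms(1)] ideal_type_add[OF assms(1)])

lemma genideal_range:
  fixes g :: "'i :: finite \<Rightarrow> 'a :: comm_ring_1"
  shows "Idl\<^bsub>ring_of_type_algebra\<^esub> (range g) = {h. \<exists>a. h = (\<Sum>i\<in>UNIV. a i * g i)}" (is "_ = ?J")
proof -
  let ?R = "ring_of_type_algebra :: 'a ring"
  interpret cring ?R by (rule cring_from_type_algebra)
  have carr: "range g \<subseteq> carrier ?R" by (simp add: ring_of_type_algebra_def)
  show ?thesis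
  proof
    have "ideal ?J ?R"
      unfolding ideal_type_iff
    proof (intro conjI ballI allI)
      show "0 \<in> ?J" by (auto intro!: exI[of _ "\<lambda>_. 0"])
      fix x assume "x \<in> ?J"
      then obtain a where x: "x = (\<Sum>i\<in>UNIV. a i * g i)" by blast
      show "r * x \<in> ?J" for r
        unfolding x by (auto intro!: exI[of _ "\<lambda>i. r * a i"] simp: sum_distrib_left mult.assoc)
      fix y assume "y \<in> ?J"
      then obtain b where y: "y = (\<Sum>i\<in>UNIV. b i * g i)" by blast
      show "x + y \<in> ?J"
        unfolding x y
        by (auto intro!: exI[of _ "\<lambda>i. a i + b i"] simp: distrib_right sum.distrib)
    qed
    moreover have "range g \<subseteq> ?J"
    proof safe
      fix j
      have "g j = (\<Sum>i\<in>UNIV. (if i = j then 1 else 0) * g i)"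
        by (simp add: if_distrib[of "\<lambda>c. c * _"] cong: if_cong)
      then show "\<exists>a. g j = (\<Sum>i\<in>UNIV. a i * g i)"
        by (rule exI[of _ "\<lambda>i. if i = j then 1 else 0"])
    qed
    ultimately show "Idl\<^bsub>?R\<^esub> (range g) \<subseteq> ?J" by (rule genideal_minimal)
    show "?J \<subseteq> Idl\<^bsub>?R\<^esub> (range g)"
      using genideal_ideal[OF carr] genideal_self[OF carr]
      by (auto intro!: ideal_type_sum ideal_type_mult)
  qed
qed

lemma mfps_max_ideal_eq_mpow: "mfps_max_ideal = mpow 1"
proof
  show "mfps_max_ideal \<subseteq> (mpow 1 :: ('a, 'b) mfps set)"
    unfolding mfps_max_ideal_def genideal_range
    using mfps_X_mem_mpow by (blast intro: mpow_sum mpow_mult1)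
  show "mpow 1 \<subseteq> (mfps_max_ideal :: ('a, 'b) mfps set)"
  proof
    fix h :: "('a, 'b) mfps"
    assume "h \<in> mpow 1"
    then have "h \<in> mpow (Suc 0)" by simp
    then obtain H where "h = (\<Sum>i\<in>UNIV. mfps_X i * H i)"
      using mpow_Suc_decomp by metis
    then show "h \<in> mfps_max_ideal"
      unfolding mfps_max_ideal_def genideal_range by (auto simp: mult.commute)
  qed
qed

text \<open>Turns the ideal powers in the definition of determinacy into orders: orders add under
  products, and \<open>mpow_Suc_decomp\<close> writes a series of order \<open>k + 1\<close> as a
  sum of products.\<close>

lemma mfps_max_ideal_pow:
  "(mfps_max_ideal :: ('a :: comm_ring_1, 'n :: finite) mfps set) [^]\<^bsub>ideals_set mfps_ring\<^esub> k = mpow k"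
proof (induction k)
  case 0
  show ?case by (auto simp: nat_pow_def ideals_set_def ring_of_type_algebra_def)
next
  case (Suc k)
  have "(mfps_max_ideal :: ('a, 'n) mfps set) [^]\<^bsub>ideals_set mfps_ring\<^esub> Suc k =
      ideal_prod mfps_ring (mpow k) (mpow 1)"
    using Suc by (simp add: nat_pow_def ideals_set_def mfps_max_ideal_eq_mpow)
  also have "\<dots> = mpow (Suc k)"
  proof
    show "ideal_prod mfps_ring (mpow k) (mpow 1) \<subseteq> (mpow (Suc k) :: ('a, 'n) mfps set)"
    proof
      fix h :: "('a, 'n) mfps"
      assume "h \<in> ideal_prod mfps_ring (mpow k) (mpow 1)"
      then show "h \<in> mpow (Suc k)"
      proof induction
        case (prod i j)
        then show ?case using mpow_mult[of i k j 1] by (simp add: ring_of_type_algebra_def)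
      next
        case (sum a b)
        then show ?case by (simp add: ring_of_type_algebra_def mpow_add)
      qed
    qed
    show "mpow (Suc k) \<subseteq> ideal_prod mfps_ring (mpow k) (mpow 1 :: ('a, 'n) mfps set)"
    proof
      fix h :: "('a, 'n) mfps"
      assume "h \<in> mpow (Suc k)"
      then obtain H where H: "h = (\<Sum>i\<in>UNIV. mfps_X i * H i)" "\<And>i. H i \<in> mpow k"
        using mpow_Suc_decomp by metis
      have prod: "a * b \<in> ideal_prod mfps_ring (mpow k) (mpow 1)"
        if "a \<in> mpow k" "b \<in> mpow 1" for a b :: "('a, 'n) mfps"
        using ideal_prod.prod[OF that, of mfps_ring] by (simp add: ring_of_type_algebra_def)
      have add: "a + b \<in> ideal_prod mfps_ring (mpow k) (mpow 1)"
        if "a \<in> ideal_prod mfps_ring (mpow k) (mpow 1)"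
          "b \<in> ideal_prod mfps_ring (mpow k) (mpow 1)" for a b :: "('a, 'n) mfps"
        using ideal_prod.sum[OF that] by (simp add: ring_of_type_algebra_def)
      have "mfps_X i * H i \<in> ideal_prod mfps_ring (mpow k) (mpow 1)" for i
        using prod[OF H(2) mfps_X_mem_mpow, of i i] by (simp only: mult.commute)
      moreover have "0 \<in> ideal_prod mfps_ring (mpow k) (mpow 1 :: ('a, 'n) mfps set)"
        using prod[of 0 0] by simp
      ultimately have "(\<Sum>i\<in>A. mfps_X i * H i) \<in> ideal_prod mfps_ring (mpow k) (mpow 1)" for A
        by (induction A rule: infinite_finite_induct)
          (simp_all only: sum.infinite sum.empty sum.insert add not_False_eq_True)
      then show "h \<in> ideal_prod mfps_ring (mpow k) (mpow 1)" unfolding H(1) .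
    qed
  qed
  finally show ?case .
qed

section \<open>Finite-dimensional quotients\<close>

interpretation mfps: vector_space "\<lambda>c (h :: ('a :: field, 'n :: finite) mfps). mfps_const c * h"
  by unfold_locales (auto simp: mfps_const_simps algebra_simps)

lemma ideal_subspace:
  "ideal I (mfps_ring :: ('a :: field, 'n :: finite) mfps ring) \<Longrightarrow> mfps.subspace I"
  by (auto simp: mfps.subspace_def ideal_type_iff)

text \<open>Moves the question from the carrier-based quotient to spans of series, where the vector
  space library applies. \<open>S\<close> consists of representatives of generators of the
  quotient.\<close>

lemma mfps_quot_dim_finite_iff_span:
  fixes I :: "('a :: field, 'n :: finite) mfps set"
  assumes I: "ideal I mfps_ring"
  shows "mfps_quot_dim I < \<infinity> \<longleftrightarrow> (\<exists>S. finite S \<and> mfps.span (S \<union> I) = UNIV)"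
proof -
  let ?R = "mfps_ring :: ('a, 'n) mfps ring"
  let ?Q = "?R Quot I"
  interpret I: ideal I ?R by (rule I)
  interpret Q: ring ?Q by (rule I.quotient_is_ring)
  define cls where "cls h = I +>\<^bsub>?R\<^esub> h" for h
  define K where "K = range (\<lambda>c. cls (mfps_const c))"
  note subspace_I = ideal_subspace[OF I]
  have cls: "cls h = (\<lambda>i. i + h) ` I" for h
    by (auto simp: cls_def a_r_coset_def' ring_of_type_algebra_def)
  have cls_eq_iff: "cls h = cls k \<longleftrightarrow> h - k \<in> I" for h k
  proof
    assume "cls h = cls k"
    moreover have "h \<in> cls h"
      unfolding cls using ideal_type_zero[OF I] by force
    ultimately show "h - k \<in> I" unfolding cls by auto
  next
    have sub: "cls h \<subseteq> cls k" if "h - k \<in> I" for h k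
    proof
      fix x assume "x \<in> cls h"
      then obtain i where "i \<in> I" "x = i + h" unfolding cls by blast
      then show "x \<in> cls k"
        unfolding cls using ideal_type_add[OF I \<open>i \<in> I\<close> that]
        by (auto intro!: image_eqI[of _ _ "i + (h - k)"])
    qed
    assume *: "h - k \<in> I"
    then have "k - h \<in> I" using mfps.subspace_neg[OF subspace_I *] by simp
    with * sub show "cls h = cls k" by blast
  qed
  have cls_0: "cls 0 = I" unfolding cls by simp
  have zero_Q: "\<zero>\<^bsub>?Q\<^esub> = I" by (simp add: FactRing_def)
  have carrier_Q: "carrier ?Q = range cls"
    by (auto simp: FactRing_def A_RCOSETS_def' cls_def ring_of_type_algebra_def)
  have hom: "cls \<in> ring_hom ?R ?Q" unfolding cls_def[abs_def] by (rule I.rcos_ring_hom)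
  have add_Q: "cls a \<oplus>\<^bsub>?Q\<^esub> cls b = cls (a + b)" for a b
    using ring_hom_add[OF hom, of a b] by (simp add: ring_of_type_algebra_def)
  have mult_Q: "cls a \<otimes>\<^bsub>?Q\<^esub> cls b = cls (a * b)" for a b
    using ring_hom_mult[OF hom, of a b] by (simp add: ring_of_type_algebra_def)
  have line: "Q.line_extension K (cls v) E =
      {cls (mfps_const c * v) \<oplus>\<^bsub>?Q\<^esub> e |c e. e \<in> E}" for v E
    unfolding Q.line_extension_def set_add_def' r_coset_def K_def by (auto simp: mult_Q)
  have dim: "mfps_quot_dim I < \<infinity> \<longleftrightarrow> (\<exists>n. Q.dimension n K (carrier ?Q))"
    by (simp add: mfps_quot_dim_def Let_def Q.finite_dimension_def K_def cls_def)
  show ?thesis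
  proof
    \<comment> \<open>The scalar set is an index of the inductive predicate, hence the separate
      variable \<open>K'\<close> with the equation \<open>K' = K\<close>.\<close>
    have "\<exists>S. finite S \<and> (\<forall>h. cls h \<in> E \<longrightarrow> h \<in> mfps.span (S \<union> I))"
      if "Q.dimension n K' E" "K' = K" for n K' E
      using that
    proof (induction rule: Q.dimension.induct)
      case (zero_dim K')
      have "h \<in> mfps.span I" if "cls h \<in> {\<zero>\<^bsub>?Q\<^esub>}" for h
        using that cls_eq_iff[of h 0] by (simp add: zero_Q cls_0 mfps.span_base)
      then show ?case by (intro exI[of _ "{}"]) auto
    next
      case (Suc_dim v E n K')
      obtain S where S: "finite S" "\<And>h. cls h \<in> E \<Longrightarrow> h \<in> mfps.span (S \<union> I)"
        using Suc_dim by auto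
      obtain w where w: "v = cls w" using Suc_dim.hyps(1) carrier_Q by auto
      \<comment> \<open>Needed to choose a representative series for an element of
        \<open>E\<close>.\<close>
      have "E \<subseteq> carrier ?Q"
        using Suc_dim.hyps(3) Suc_dim.prems
      proof (induction rule: Q.dimension.induct)
        case (zero_dim K')
        then show ?case by simp
      next
        case (Suc_dim v E n K')
        then have "v \<in> range cls" "E \<subseteq> range cls" by (simp_all add: carrier_Q)
        then show ?case
          unfolding \<open>K' = K\<close> carrier_Q by (fastforce simp: line add_Q)
      qed
      have "h \<in> mfps.span (insert w S \<union> I)" if h: "cls h \<in> Q.line_extension K v E" for h
      proof -
        obtain c e where e: "e \<in> E" "cls h = cls (mfps_const c * w) \<oplus>\<^bsub>?Q\<^esub> e"
          using h unfolding w line by auto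
        obtain g where g: "e = cls g" using e(1) \<open>E \<subseteq> carrier ?Q\<close> carrier_Q by auto
        have "h - (mfps_const c * w + g) \<in> I"
          using e(2) by (simp add: g add_Q cls_eq_iff)
        moreover have "g \<in> mfps.span (insert w S \<union> I)"
          using S(2)[of g] e(1) g mfps.span_mono[of "S \<union> I" "insert w S \<union> I"] by auto
        moreover have "mfps_const c * w \<in> mfps.span (insert w S \<union> I)"
          by (intro mfps.span_scale mfps.span_base) simp
        ultimately have "(h - (mfps_const c * w + g)) + (mfps_const c * w + g)
            \<in> mfps.span (insert w S \<union> I)"
          by (intro mfps.span_add) (auto intro: mfps.span_base)
        then show ?thesis by simp
      qed
      then show ?case using S(1) Suc_dim.prems by (intro exI[of _ "insert w S"]) auto
    qed
    moreover assume "mfps_quot_dim I < \<infinity>"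
    ultimately obtain S where "finite S" "\<And>h. cls h \<in> carrier ?Q \<Longrightarrow> h \<in> mfps.span (S \<union> I)"
      unfolding dim by metis
    then show "\<exists>S. finite S \<and> mfps.span (S \<union> I) = UNIV"
      unfolding carrier_Q by auto
  next
    assume "\<exists>S. finite S \<and> mfps.span (S \<union> I) = UNIV"
    then obtain S where S: "finite S" "mfps.span (S \<union> I) = UNIV" by blast
    have "\<exists>n. Q.dimension n K (cls ` mfps.span (S \<union> I))"
      using S(1)
    proof (induction S)
      case empty
      have "mfps.span I = I" using subspace_I by (simp add: mfps.span_eq_iff)
      moreover have "cls ` I = {\<zero>\<^bsub>?Q\<^esub>}"
        using cls_eq_iff[of _ 0] ideal_type_zero[OF I] by (auto simp: zero_Q cls_0)
      ultimately have "Q.dimension 0 K (cls ` mfps.span I)" by (simp only: Q.zero_dim)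
      then show ?case by auto
    next
      case (insert s S)
      then obtain n where n: "Q.dimension n K (cls ` mfps.span (S \<union> I))" by blast
      show ?case
      \<comment> \<open>A class already reached leaves the span unchanged; only a new one extends
        the dimension by one.\<close>
      proof (cases "cls s \<in> cls ` mfps.span (S \<union> I)")
        case True
        then obtain t where "t \<in> mfps.span (S \<union> I)" "s - t \<in> I"
          by (auto simp: cls_eq_iff)
        then have "(s - t) + t \<in> mfps.span (S \<union> I)"
          by (intro mfps.span_add) (auto intro: mfps.span_base)
        then have "mfps.span (insert s S \<union> I) = mfps.span (S \<union> I)"
          by (simp add: mfps.span_redundant)
        with n show ?thesis by auto
      next
        case False
        have "Q.line_extension K (cls s) (cls ` mfps.span (S \<union> I)) =
            cls ` mfps.span (insert s S \<union> I)"
        proof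
          show "Q.line_extension K (cls s) (cls ` mfps.span (S \<union> I)) \<subseteq>
              cls ` mfps.span (insert s S \<union> I)"
            unfolding line
          proof safe
            fix c g assume "g \<in> mfps.span (S \<union> I)"
            then have "g \<in> mfps.span (insert s S \<union> I)"
              using mfps.span_mono[of "S \<union> I" "insert s S \<union> I"] by blast
            then have "mfps_const c * s + g \<in> mfps.span (insert s S \<union> I)"
              by (intro mfps.span_add mfps.span_scale) (auto intro: mfps.span_base)
            then show "cls (mfps_const c * s) \<oplus>\<^bsub>?Q\<^esub> cls g \<in> cls ` mfps.span (insert s S \<union> I)"
              unfolding add_Q by (rule imageI)
          qed
          show "cls ` mfps.span (insert s S \<union> I) \<subseteq>
              Q.line_extension K (cls s) (cls ` mfps.span (S \<union> I))"
          proof safe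
            fix h assume "h \<in> mfps.span (insert s S \<union> I)"
            then obtain c where c: "h - mfps_const c * s \<in> mfps.span (S \<union> I)"
              by (auto simp: mfps.span_breakdown_eq)
            have "cls h = cls (mfps_const c * s) \<oplus>\<^bsub>?Q\<^esub> cls (h - mfps_const c * s)"
              by (simp add: add_Q)
            with c show "cls h \<in> Q.line_extension K (cls s) (cls ` mfps.span (S \<union> I))"
              unfolding line by blast
          qed
        qed
        moreover have "cls s \<in> carrier ?Q" by (simp add: carrier_Q)
        ultimately show ?thesis using Q.Suc_dim[OF _ False n] by metis
      qed
    qed
    then show "mfps_quot_dim I < \<infinity>"
      unfolding dim carrier_Q S(2) .
  qed
qed

text \<open>Gaussian elimination on the finite set \<open>S\<close>: a vector that involves
  \<open>s\<close> serves as pivot and removes \<open>s\<close> from all later vectors, to which the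
  induction hypothesis applies.\<close>

lemma span_ex_dependent_mod:
  fixes w :: "nat \<Rightarrow> ('a :: field, 'n :: finite) mfps"
  assumes "finite S" "\<And>e. w e \<in> mfps.span (S \<union> I)"
  shows "\<exists>n. w n \<in> mfps.span (w ` {..<n} \<union> I)"
  using assms
proof (induction S arbitrary: w)
  case empty
  then show ?case by (intro exI[of _ 0]) simp
next
  case (insert s S)
  have "\<exists>k. w e - mfps_const k * s \<in> mfps.span (S \<union> I)" for e
    using insert.prems[of e] by (simp add: mfps.span_breakdown_eq)
  then obtain k where k: "\<And>e. w e - mfps_const (k e) * s \<in> mfps.span (S \<union> I)" by metis
  show ?case
  proof (cases "\<forall>e. k e = 0")
    case True
    then show ?thesis using insert.IH[of w] k by (simp add: mfps_const_simps)
  next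
    case False
    then obtain d where d: "k d \<noteq> 0" by blast
    \<comment> \<open>The factor by which the pivot \<open>w d\<close> must be scaled to cancel the
      \<open>s\<close>-component of \<open>w (d + 1 + e)\<close>.\<close>
    define r where "r e = k (d + 1 + e) / k d" for e
    define w' where "w' e = w (d + 1 + e) - mfps_const (r e) * w d" for e
    have "w' e \<in> mfps.span (S \<union> I)" for e
    proof -
      have "mfps_const (r e) * (mfps_const (k d) * s) = mfps_const (k (d + 1 + e)) * s"
        using d by (simp add: r_def mfps_const_simps(4)[symmetric] mult.assoc[symmetric])
      then have "w' e = (w (d + 1 + e) - mfps_const (k (d + 1 + e)) * s) -
          mfps_const (r e) * (w d - mfps_const (k d) * s)"
        by (simp add: w'_def right_diff_distrib)
      then show ?thesis
        using mfps.span_diff[OF k mfps.span_scale[OF k]] by simp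
    qed
    then obtain n where n: "w' n \<in> mfps.span (w' ` {..<n} \<union> I)"
      using insert.IH by blast
    let ?V = "mfps.span (w ` {..<d + 1 + n} \<union> I)"
    have w_d: "w d \<in> ?V" by (intro mfps.span_base) auto
    have "mfps.span (w' ` {..<n} \<union> I) \<subseteq> ?V"
    proof (rule mfps.span_minimal)
      show "w' ` {..<n} \<union> I \<subseteq> ?V"
        using w_d by (auto simp: w'_def intro!: mfps.span_diff mfps.span_scale intro: mfps.span_base)
    qed (rule mfps.subspace_span)
    with n have "w' n + mfps_const (r n) * w d \<in> ?V"
      by (intro mfps.span_add mfps.span_scale w_d) auto
    then show ?thesis by (intro exI[of _ "d + 1 + n"]) (simp add: w'_def)
  qed
qed

lemma single_eq_iff: "0(i := a) = 0(i := b) \<longleftrightarrow> a = b" for a b :: nat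
  by (metis fun_upd_same)

text \<open>
  If the powers of \<open>x\<^sub>i\<close> are linearly dependent modulo \<open>I\<close>, then \<open>I\<close> contains a nonzero polynomial in
  \<open>x\<^sub>i\<close>, which is a unit times a power of \<open>x\<^sub>i\<close>.
\<close>

lemma ideal_contains_power:
  fixes I :: "('a :: field, 'n :: finite) mfps set"
  assumes I: "ideal I mfps_ring" and S: "finite S"
    and powers: "\<And>e. mfps_monom (0(i := e)) \<in> mfps.span (S \<union> I)"
  shows "\<exists>e. mfps_monom (0(i := e)) \<in> I"
proof -
  define w where "w e = (mfps_monom (0(i := e)) :: ('a, 'n) mfps)" for e
  obtain n where "w n \<in> mfps.span (w ` {..<n} \<union> I)"
    using span_ex_dependent_mod[OF S, of w I] powers by (auto simp: w_def)
  then obtain q r where q: "q \<in> mfps.span (w ` {..<n})" and r: "r \<in> mfps.span I" "w n = q + r"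
    by (auto simp: mfps.span_Un)
  have "r \<in> I" using r(1) ideal_subspace[OF I] by (metis mfps.span_eq_iff)
  \<comment> \<open>\<open>q\<close> is a polynomial in the \<open>i\<close>-th variable without the
    term of degree \<open>n\<close>, so \<open>r = w n - q\<close> has coefficient 1 there and is
    nonzero.\<close>
  have "q \<in> {q. (\<forall>m. mfps_nth q m \<noteq> 0 \<longrightarrow> m = 0(i := m i)) \<and> mfps_nth q (0(i := n)) = 0}"
  proof (rule subsetD[OF mfps.span_minimal q])
    show "w ` {..<n} \<subseteq> {q. (\<forall>m. mfps_nth q m \<noteq> 0 \<longrightarrow> m = 0(i := m i)) \<and> mfps_nth q (0(i := n)) = 0}"
      by (auto simp: w_def single_eq_iff simp del: fun_upd_apply split: if_splits) (simp add: fun_upd_same)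
    show "mfps.subspace {q. (\<forall>m. mfps_nth q m \<noteq> 0 \<longrightarrow> m = 0(i := m i)) \<and> mfps_nth q (0(i := n)) = 0}"
      by (auto simp: mfps.subspace_def) (metis add.right_neutral)
  qed
  moreover have "r = w n - q" using r(2) by simp
  ultimately have r_n: "mfps_nth r (0(i := n)) = 1"
    and "\<forall>m. mfps_nth r m \<noteq> 0 \<longrightarrow> m = 0(i := m i)"
    by (auto simp: w_def split: if_splits)
  then have supp: "m = 0(i := m i)" if "mfps_nth r m \<noteq> 0" for m
    using that by blast
  \<comment> \<open>The order of \<open>r\<close>: dividing by this power of the variable leaves a
    series \<open>h\<close> with nonzero constant coefficient.\<close>
  define e where "e = (LEAST e. mfps_nth r (0(i := e)) \<noteq> 0)"
  have e: "mfps_nth r (0(i := e)) \<noteq> 0"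
    unfolding e_def by (rule LeastI[of "\<lambda>e. mfps_nth r (0(i := e)) \<noteq> 0" n]) (simp only: r_n, simp)
  have e_least: "e \<le> m i" if "mfps_nth r m \<noteq> 0" for m
    unfolding e_def using that supp[OF that] by (intro Least_le) simp
  define h where "h = Abs_mfps (\<lambda>m. mfps_nth r (m + 0(i := e)))"
  have "mfps_monom (0(i := e)) * h = r"
  proof (rule mfps_eqI)
    fix m
    have "m - 0(i := e) + 0(i := e) = m" if "e \<le> m i"
      using that by (auto simp: fun_eq_iff)
    then show "mfps_nth (mfps_monom (0(i := e)) * h) m = mfps_nth r m"
      using e_least[of m] unfolding mfps_nth_monom_mult single_le_iff h_def mfps_nth_Abs by auto
  qed
  moreover have "h dvd 1"
    unfolding mfps_unit_iff mpow_1_iff using e by (simp add: h_def del: fun_upd_apply)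
  then obtain h' where "h * h' = 1" by (metis dvdE)
  ultimately have "mfps_monom (0(i := e)) = h' * r"
    by (metis mult.assoc mult.commute mult_1)
  then show ?thesis using ideal_type_mult[OF I \<open>r \<in> I\<close>] by metis
qed

text \<open>Induction on the total degree of \<open>e\<close>. The colon ideal \<open>J\<close> of
  \<open>I\<close> by \<open>mfps_X i\<close> contains the required powers with the exponent at
  \<open>i\<close> lowered by one; if that exponent is 0, then \<open>I\<close> contains 1.\<close>

lemma mpow_subset_ideal:
  fixes I :: "('a :: comm_ring_1, 'n :: finite) mfps set" and e :: "'n \<Rightarrow> nat"
  assumes "ideal I mfps_ring" "\<And>i. mfps_monom (0(i := e i)) \<in> I"
  shows "mpow (mdeg e) \<subseteq> I"
  using assms
proof (induction "mdeg e" arbitrary: e I)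
  case 0
  then have "e = 0" by simp
  then have "0(i := e i) = 0" for i :: 'n by auto
  then have "1 \<in> I" using "0.prems"(2) by (metis mfps_monom_0)
  then show ?case using ideal_type_mult[OF "0.prems"(1), of 1] by auto
next
  case (Suc k)
  show ?case
  proof
    fix h :: "('a, 'n) mfps" assume "h \<in> mpow (mdeg e)"
    then have "h \<in> mpow (Suc k)" using Suc.hyps(2) by simp
    then obtain H where H: "h = (\<Sum>i\<in>UNIV. mfps_X i * H i)" "\<And>i. H i \<in> mpow k"
      using mpow_Suc_decomp by metis
    have "mfps_X i * H i \<in> I" for i
    proof (cases "e i")
      case 0
      have "0(i := 0 :: nat) = 0" by auto
      then have "1 \<in> I" using Suc.prems(2)[of i] 0 by (metis mfps_monom_0)
      then show ?thesis using ideal_type_mult[OF Suc.prems(1), of 1] by auto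
    next
      case (Suc l)
      define J where "J = {h. mfps_X i * h \<in> I}"
      define e' where "e' = e(i := l)"
      have J: "ideal J mfps_ring"
        using Suc.prems(1) by (auto simp: J_def ideal_type_iff distrib_left mult.left_commute)
      have "e' + 0(i := 1) = e" using Suc by (auto simp: e'_def fun_eq_iff)
      then have "Suc (mdeg e') = mdeg e"
        using mdeg_add[of e' "0(i := 1)"] by (simp only: mdeg_single)
      then have "k = mdeg e'" using Suc.hyps(2) by simp
      moreover have "mfps_monom (0(j := e' j)) \<in> J" for j
      proof (cases "j = i")
        case True
        have "0(i := 1) + 0(i := l) = 0(i := Suc l)" by (auto simp: fun_eq_iff)
        then have "mfps_X i * mfps_monom (0(i := l)) =
            (mfps_monom (0(i := e i)) :: ('a, 'n) mfps)"
          by (simp only: mfps_X_eq_monom mfps_monom_mult \<open>e i = Suc l\<close>)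
        then have "mfps_X i * mfps_monom (0(i := l)) \<in> I"
          using Suc.prems(2)[of i] by (simp only:)
        then show ?thesis using True by (simp add: J_def e'_def)
      next
        case False
        then show ?thesis
          using ideal_type_mult[OF Suc.prems(1) Suc.prems(2)[of j]] by (simp add: J_def e'_def)
      qed
      ultimately have "mpow (mdeg e') \<subseteq> J" by (intro Suc.hyps(1) J)
      then show ?thesis using H(2)[of i] \<open>k = mdeg e'\<close> by (auto simp: J_def)
    qed
    then show "h \<in> I" unfolding H(1) by (intro ideal_type_sum[OF Suc.prems(1)])
  qed
qed

lemma mpow_subset_if_powers_in_span:
  fixes I :: "('a :: field, 'n :: finite) mfps set"
  assumes "ideal I mfps_ring" "finite S" "\<And>i e. mfps_monom (0(i := e)) \<in> mfps.span (S \<union> I)"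
  shows "\<exists>j. mpow j \<subseteq> I"
proof -
  have "\<exists>e. mfps_monom (0(i := e)) \<in> I" for i
    using ideal_contains_power[OF assms(1,2)] assms(3) by blast
  then obtain e where "\<And>i. mfps_monom (0(i := e i)) \<in> I" by metis
  then show ?thesis using mpow_subset_ideal[OF assms(1)] by blast
qed

lemma mfps_quot_dim_finite_iff:
  fixes I :: "('a :: field, 'n :: finite) mfps set"
  assumes I: "ideal I mfps_ring"
  shows "mfps_quot_dim I < \<infinity> \<longleftrightarrow> (\<exists>j. mpow j \<subseteq> I)"
proof
  assume "mfps_quot_dim I < \<infinity>"
  then obtain S where S: "finite S" "mfps.span (S \<union> I) = UNIV"
    unfolding mfps_quot_dim_finite_iff_span[OF I] by blast
  show "\<exists>j. mpow j \<subseteq> I"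
    by (rule mpow_subset_if_powers_in_span[OF I S(1)]) (simp add: S(2))
next
  assume "\<exists>j. mpow j \<subseteq> I"
  then obtain j where j: "mpow j \<subseteq> I" by blast
  \<comment> \<open>The monomials of degree below \<open>j\<close> span everything modulo
    \<open>mpow j\<close>.\<close>
  define S where "S = (mfps_monom :: _ \<Rightarrow> ('a, 'n) mfps) ` {m. mdeg m < j}"
  have "h \<in> mfps.span (S \<union> I)" for h
  proof -
    define p where "p = (\<Sum>a | mdeg a < j. mfps_const (mfps_nth h a) * mfps_monom a)"
    have "p \<in> mfps.span (S \<union> I)"
      unfolding p_def
      by (intro mfps.span_sum mfps.span_scale) (auto simp: S_def intro: mfps.span_base)
    moreover have "h - p \<in> mpow j"
      by (rule mpowI) (simp add: p_def mfps_nth_sum if_distrib[of "\<lambda>c. _ * c"] cong: if_cong)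
    then have "h - p \<in> mfps.span (S \<union> I)" using j by (auto intro: mfps.span_base)
    ultimately have "(h - p) + p \<in> mfps.span (S \<union> I)" by (intro mfps.span_add)
    then show ?thesis by simp
  qed
  moreover have "finite S" by (simp add: S_def)
  ultimately show "mfps_quot_dim I < \<infinity>"
    unfolding mfps_quot_dim_finite_iff_span[OF I] by blast
qed

section \<open>Tangent ideals\<close>

text \<open>
  The set \<open>B\<close> selects the equivalence relation: \<open>{0}\<close> for right equivalence, where no multiple of \<open>f\<close>
  is allowed and the unit is \<open>1\<close>, and \<open>UNIV\<close> for contact equivalence.
\<close>

definition tangent ::
    "('a :: comm_ring_1, 'n :: finite) mfps set \<Rightarrow> ('a, 'n) mfps \<Rightarrow> ('a, 'n) mfps set" where
  "tangent B f = {b * f + (\<Sum>i\<in>UNIV. a i * mfps_deriv i f) |a b. b \<in> B}"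

definition mfps_equiv ::
    "('a :: comm_ring_1, 'n :: finite) mfps set \<Rightarrow> ('a, 'n) mfps \<Rightarrow> ('a, 'n) mfps \<Rightarrow> bool" where
  "mfps_equiv B f g \<longleftrightarrow>
    (\<exists>\<phi> u. mfps_alg_hom \<phi> \<and> bij \<phi> \<and> u dvd 1 \<and> u - 1 \<in> B \<and> f = u * \<phi> g)"

lemma right_equivalent_iff: "right_equivalent f g \<longleftrightarrow> mfps_equiv {0} f g"
  unfolding right_equivalent_def mfps_equiv_def Bex_def mfps_automorphisms_iff by auto

lemma contact_equivalent_iff: "contact_equivalent f g \<longleftrightarrow> mfps_equiv UNIV f g"
  unfolding contact_equivalent_def mfps_equiv_def Bex_def mfps_automorphisms_iff by auto

lemma tangent_eq_genideal:
  "tangent {0} f = Idl\<^bsub>mfps_ring\<^esub> (range (\<lambda>i. mfps_deriv i f))"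
  "tangent UNIV f = Idl\<^bsub>mfps_ring\<^esub> (insert f (range (\<lambda>i. mfps_deriv i f)))"
proof -
  show "tangent {0} f = Idl\<^bsub>mfps_ring\<^esub> (range (\<lambda>i. mfps_deriv i f))"
    unfolding genideal_range by (auto simp: tangent_def)
  \<comment> \<open>The option type indexes \<open>f\<close> together with its derivatives, so that
    \<open>genideal_range\<close> applies.\<close>
  let ?g = "case_option f (\<lambda>i. mfps_deriv i f)"
  have "insert f (range (\<lambda>i. mfps_deriv i f)) = range ?g"
    by (simp add: UNIV_option_conv image_image)
  moreover have sum: "(\<Sum>i\<in>UNIV. a i * ?g i) = a None * f + (\<Sum>i\<in>UNIV. a (Some i) * mfps_deriv i f)"
    for a :: "_ \<Rightarrow> ('a, 'b) mfps"
    by (simp add: UNIV_option_conv sum.reindex)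
  moreover have "tangent UNIV f = {h. \<exists>a. h = (\<Sum>i\<in>UNIV. a i * ?g i)}"
  proof -
    have "\<exists>a'. b * f + (\<Sum>i\<in>UNIV. a i * mfps_deriv i f) =
        a' None * f + (\<Sum>i\<in>UNIV. a' (Some i) * mfps_deriv i f)" for a b
      by (rule exI[of _ "case_option b a"]) simp
    then show ?thesis by (auto simp: tangent_def sum)
  qed
  ultimately show "tangent UNIV f = Idl\<^bsub>mfps_ring\<^esub> (insert f (range (\<lambda>i. mfps_deriv i f)))"
    by (simp only: genideal_range)
qed

lemma ideal_tangent: "B = {0} \<or> B = UNIV \<Longrightarrow> ideal (tangent B f) mfps_ring"
proof -
  have "ideal (Idl\<^bsub>mfps_ring\<^esub> A) mfps_ring" for A :: "('a, 'b) mfps set"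
    by (rule ring.genideal_ideal[OF ring_from_type_algebra]) (simp add: ring_of_type_algebra_def)
  then show "B = {0} \<or> B = UNIV \<Longrightarrow> ideal (tangent B f) mfps_ring"
    by (auto simp: tangent_eq_genideal)
qed

lemma milnor_number_finite_iff:
  "milnor_number f < \<infinity> \<longleftrightarrow> (\<exists>j. mpow j \<subseteq> tangent {0} f)"
  unfolding milnor_number_def tangent_eq_genideal(1)[symmetric]
  by (rule mfps_quot_dim_finite_iff) (simp add: ideal_tangent)

lemma tjurina_number_finite_iff:
  "tjurina_number f < \<infinity> \<longleftrightarrow> (\<exists>j. mpow j \<subseteq> tangent UNIV f)"
  unfolding tjurina_number_def tangent_eq_genideal(2)[symmetric]
  by (rule mfps_quot_dim_finite_iff) (simp add: ideal_tangent)

lemma self_mem_tangent: "b \<in> B \<Longrightarrow> b * f \<in> tangent B f"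
  unfolding tangent_def by (rule CollectI, rule exI[of _ "\<lambda>_. 0"]) auto

lemma deriv_mem_tangent:
  assumes "B = {0} \<or> B = UNIV"
  shows "mfps_deriv i f \<in> tangent B f"
proof -
  have "mfps_deriv i f = 0 * f + (\<Sum>j\<in>UNIV. (if j = i then 1 else 0) * mfps_deriv j f)"
    by (simp add: if_distrib[of "\<lambda>c. c * _"] cong: if_cong)
  then show ?thesis
    unfolding tangent_def using assms
    by (intro CollectI exI[of _ "\<lambda>j. if j = i then 1 else 0"] exI[of _ 0]) auto
qed

lemma tangent_subset_ideal:
  assumes "ideal I mfps_ring" "\<And>b. b \<in> B \<Longrightarrow> b * f \<in> I" "\<And>i. mfps_deriv i f \<in> I"
  shows "tangent B f \<subseteq> I"
  unfolding tangent_def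
  by (auto intro!: ideal_type_add[OF assms(1)] ideal_type_sum[OF assms(1)] assms(2)
      ideal_type_mult[OF assms(1) assms(3)])

section \<open>Derivations and invariance of tangent ideals\<close>

text \<open>The error \<open>E\<close> satisfies
  \<open>E h = (\<Sum>i\<in>UNIV. mfps_X i * E (H i))\<close>, so it gains an order at each step and
  lies in every \<open>mpow N\<close>.\<close>

lemma mfps_derivation_eq:
  fixes D :: "('a :: comm_ring_1, 'n :: finite) mfps \<Rightarrow> ('a, 'n) mfps"
  assumes add: "\<And>g h. D (g + h) = D g + D h"
    and mult: "\<And>g h. D (g * h) = D g * h + g * D h"
    and const: "\<And>c. D (mfps_const c) = 0"
  shows "D h = (\<Sum>j\<in>UNIV. D (mfps_X j) * mfps_deriv j h)"
proof (rule mfps_eqI_mpow)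
  define E where "E h = D h - (\<Sum>j\<in>UNIV. D (mfps_X j) * mfps_deriv j h)" for h
  have D_sum: "D (\<Sum>x\<in>A. F x) = (\<Sum>x\<in>A. D (F x))" for A :: "'n set" and F
    using const[of 0]
    by (induction A rule: infinite_finite_induct) (simp_all add: add mfps_const_simps)
  have "E h \<in> mpow N" for N
  proof (induction N arbitrary: h)
    case (Suc N)
    obtain c H where h: "h = mfps_const c + (\<Sum>i\<in>UNIV. mfps_X i * H i)"
      by (rule mfps_decomp)
    have D_h: "D h = (\<Sum>i\<in>UNIV. D (mfps_X i) * H i + mfps_X i * D (H i))"
      by (simp add: h add const D_sum mult)
    have "E h = (\<Sum>i\<in>UNIV. mfps_X i * E (H i))"
      unfolding E_def sum_deriv_decomp[OF h] D_h sum_subtractf[symmetric]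
      by (intro sum.cong) (simp_all add: right_diff_distrib)
    moreover have "mfps_X i * E (H i) \<in> mpow (Suc N)" for i
      using mpow_mult[OF mfps_X_mem_mpow Suc.IH] by simp
    ultimately show ?case by (auto intro: mpow_sum)
  qed simp
  then show "D h - (\<Sum>j\<in>UNIV. D (mfps_X j) * mfps_deriv j h) \<in> mpow s" for s
    unfolding E_def .
qed

text \<open>
  \<open>\<phi> (\<partial>\<^sub>i g) = D (\<phi> g)\<close> for the derivation \<open>D = \<phi> \<circ> \<partial>\<^sub>i \<circ> \<phi>\<^sup>-\<^sup>1\<close>, and every derivation is a combination
  of the \<open>\<partial>\<^sub>j\<close>.
\<close>

lemma automorphism_image_tangent:
  assumes B: "B = {0} \<or> B = UNIV" and \<phi>: "mfps_alg_hom \<phi>" "bij \<phi>"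
    and h: "h \<in> tangent B g"
  shows "\<phi> h \<in> tangent B (\<phi> g)"
proof -
  interpret \<phi>: mfps_alg_hom \<phi> by fact
  obtain \<psi> where \<psi>: "mfps_alg_hom \<psi>" "\<And>x. \<phi> (\<psi> x) = x" "\<And>x. \<psi> (\<phi> x) = x"
    using mfps_alg_hom_inverse[OF \<phi>] by metis
  interpret \<psi>: mfps_alg_hom \<psi> by fact
  note I = ideal_tangent[OF B, of "\<phi> g"]
  have deriv: "\<phi> (mfps_deriv i g) \<in> tangent B (\<phi> g)" for i
  proof -
    define D where "D x = \<phi> (mfps_deriv i (\<psi> x))" for x
    have "D (\<phi> g) = (\<Sum>j\<in>UNIV. D (mfps_X j) * mfps_deriv j (\<phi> g))"
      by (rule mfps_derivation_eq) (simp_all add: D_def \<psi> mfps_deriv_add mfps_deriv_mult)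
    also have "\<dots> \<in> tangent B (\<phi> g)"
      by (intro ideal_type_sum[OF I] ideal_type_mult[OF I] deriv_mem_tangent B)
    finally show ?thesis by (simp add: D_def \<psi>)
  qed
  obtain a b where "b \<in> B" "h = b * g + (\<Sum>i\<in>UNIV. a i * mfps_deriv i g)"
    using h unfolding tangent_def by blast
  moreover from this B have "\<phi> b \<in> B" by auto
  ultimately show ?thesis
    using deriv
    by (auto simp: \<phi>.sum intro!: ideal_type_add[OF I] ideal_type_sum[OF I] ideal_type_mult[OF I]
        self_mem_tangent)
qed

text \<open>For right equivalence \<open>u = 1\<close>. For contact equivalence write
  \<open>g = v * (u * g)\<close>; the product rule expresses the derivatives of \<open>g\<close> by
  \<open>u * g\<close> and its derivatives.\<close>

lemma tangent_unit_mult: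
  assumes B: "B = {0} \<or> B = UNIV" and u: "u dvd 1" "u - 1 \<in> B"
  shows "tangent B g \<subseteq> tangent B (u * g)"
proof (cases "B = {0}")
  case True
  then show ?thesis using u by simp
next
  case False
  then have "B = UNIV" using B by simp
  note I = ideal_tangent[OF B, of "u * g"]
  obtain v where "u * v = 1" using u(1) by (metis dvdE)
  then have g: "g = v * (u * g)" by (metis mult.assoc mult.commute mult_1)
  have "mfps_deriv i (v * (u * g)) \<in> tangent B (u * g)" for i
    unfolding mfps_deriv_mult[of i v]
    by (intro ideal_type_add[OF I] ideal_type_mult[OF I] deriv_mem_tangent self_mem_tangent B)
      (simp add: \<open>B = UNIV\<close>)
  moreover have "b * (v * (u * g)) \<in> tangent B (u * g)" for b
    unfolding mult.assoc[symmetric, of b v] by (rule self_mem_tangent) (simp add: \<open>B = UNIV\<close>)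
  ultimately show ?thesis
    unfolding g[symmetric] by (intro tangent_subset_ideal[OF I])
qed

text \<open>Pull back by the inverse automorphism, which preserves order, and push forward. The
  exponent \<open>j\<close> stays the same, which keeps the Newton iteration uniform.\<close>

lemma mpow_subset_tangent_transform:
  fixes g :: "('a :: field, 'n :: finite) mfps"
  assumes B: "B = {0} \<or> B = UNIV" and \<phi>: "mfps_alg_hom \<phi>" "bij \<phi>"
    and u: "u dvd 1" "u - 1 \<in> B" and j: "mpow j \<subseteq> tangent B g"
  shows "mpow j \<subseteq> tangent B (u * \<phi> g)"
proof
  fix h :: "('a, 'n) mfps" assume h: "h \<in> mpow j"
  obtain \<psi> where \<psi>: "mfps_alg_hom \<psi>" "bij \<psi>" "\<And>x. \<phi> (\<psi> x) = x"
    using mfps_alg_hom_inverse[OF \<phi>] by metis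
  have "\<psi> h \<in> tangent B g"
    using mfps_automorphism_mpow[OF \<psi>(1,2) h] j by blast
  from automorphism_image_tangent[OF B \<phi> this] show "h \<in> tangent B (u * \<phi> g)"
    using tangent_unit_mult[OF B u, of "\<phi> g"] by (auto simp: \<psi>(3))
qed

lemma mfps_equiv_sym:
  assumes B: "B = {0} \<or> B = UNIV" and "mfps_equiv B f g"
  shows "mfps_equiv B g f"
proof -
  obtain \<phi> u where \<phi>: "mfps_alg_hom \<phi>" "bij \<phi>" and u: "u dvd 1" "u - 1 \<in> B" and f: "f = u * \<phi> g"
    using assms(2) unfolding mfps_equiv_def by blast
  obtain \<psi> where \<psi>: "mfps_alg_hom \<psi>" "bij \<psi>" "\<And>x. \<psi> (\<phi> x) = x"
    using mfps_alg_hom_inverse[OF \<phi>] by metis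
  interpret \<psi>: mfps_alg_hom \<psi> by fact
  obtain v where v: "u * v = 1" using u(1) by (metis dvdE)
  have uv: "\<psi> v * \<psi> u = 1" using v by (metis \<psi>.mult \<psi>.one mult.commute)
  then have "g = \<psi> v * \<psi> f" by (simp add: f \<psi>(3) mult.assoc[symmetric])
  moreover have "\<psi> v dvd 1" using uv by (metis dvd_triv_left)
  moreover have "\<psi> v - 1 \<in> B" using B u(2) v by auto
  ultimately show ?thesis unfolding mfps_equiv_def using \<psi>(1,2) by blast
qed

section \<open>Finite determinacy\<close>

text \<open>The surplus order \<open>M\<close> is passed to the coefficients: split off one variable
  at a time and multiply the coefficients of each \<open>H l\<close> by that variable.\<close>

lemma tangent_coeffs_mem_mpow:
  assumes B: "B = {0} \<or> B = UNIV" and j: "mpow j \<subseteq> tangent B g"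
    and "d \<in> mpow (M + j)"
  shows "\<exists>a b. b \<in> B \<inter> mpow M \<and> (\<forall>i. a i \<in> mpow M) \<and>
    d = b * g + (\<Sum>i\<in>UNIV. a i * mfps_deriv i g)"
  using assms(3)
proof (induction M arbitrary: d)
  case 0
  then have "d \<in> tangent B g" using j by auto
  then show ?case by (auto simp: tangent_def)
next
  case (Suc M)
  then obtain H where H: "d = (\<Sum>l\<in>UNIV. mfps_X l * H l)" "\<And>l. H l \<in> mpow (M + j)"
    using mpow_Suc_decomp[of d "M + j"] by auto
  \<comment> \<open>Both kinds of coefficients are packed into one pair, so that a single use of
    \<open>choice\<close> selects them.\<close>
  have "\<forall>l. \<exists>x. snd x \<in> B \<inter> mpow M \<and> (\<forall>i. fst x i \<in> mpow M) \<and>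
      H l = snd x * g + (\<Sum>i\<in>UNIV. fst x i * mfps_deriv i g)"
    using Suc.IH[OF H(2)] by simp
  from choice[OF this] obtain F where F: "\<forall>l. snd (F l) \<in> B \<inter> mpow M \<and>
      (\<forall>i. fst (F l) i \<in> mpow M) \<and>
      H l = snd (F l) * g + (\<Sum>i\<in>UNIV. fst (F l) i * mfps_deriv i g)" ..
  define a where "a l = fst (F l)" for l
  define b where "b l = snd (F l)" for l
  have ab: "b l \<in> B \<inter> mpow M" "a l i \<in> mpow M"
    "H l = b l * g + (\<Sum>i\<in>UNIV. a l i * mfps_deriv i g)" for l i
    unfolding a_def b_def using F by blast+
  define b' where "b' = (\<Sum>l\<in>UNIV. mfps_X l * b l)"
  define a' where "a' i = (\<Sum>l\<in>UNIV. mfps_X l * a l i)" for i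
  have X: "mfps_X l * x \<in> mpow (Suc M)" if "x \<in> mpow M" for l and x :: "('a, 'b) mfps"
    using mpow_mult[OF mfps_X_mem_mpow that] by simp
  have "b' \<in> B"
    using B ab(1) by (auto simp: b'_def)
  moreover have "b' \<in> mpow (Suc M)" "a' i \<in> mpow (Suc M)" for i
    using ab(1,2) by (auto simp: b'_def a'_def intro!: mpow_sum X)
  moreover have "d = b' * g + (\<Sum>i\<in>UNIV. a' i * mfps_deriv i g)"
  proof -
    have "mfps_X l * H l =
        mfps_X l * b l * g + (\<Sum>i\<in>UNIV. mfps_X l * a l i * mfps_deriv i g)" for l
      by (simp add: ab(3) distrib_left sum_distrib_left mult.assoc)
    then have "d = b' * g + (\<Sum>l\<in>UNIV. \<Sum>i\<in>UNIV. mfps_X l * a l i * mfps_deriv i g)"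
      unfolding H(1) b'_def sum_distrib_right sum.distrib[symmetric] by simp
    also have "(\<Sum>l\<in>UNIV. \<Sum>i\<in>UNIV. mfps_X l * a l i * mfps_deriv i g) =
        (\<Sum>i\<in>UNIV. a' i * mfps_deriv i g)"
      by (subst sum.swap) (simp add: a'_def sum_distrib_right)
    finally show ?thesis .
  qed
  ultimately show ?case by (intro exI[of _ a'] exI[of _ b']) auto
qed

text \<open>
  The Newton iteration: if \<open>f - g = b * g + \<Sum>i. a\<^sub>i * \<partial>\<^sub>i g\<close> with coefficients of order \<open>M\<close>, then
  replacing \<open>g\<close> by \<open>(1 + b) * g(x + a)\<close> makes the difference of order \<open>2 * M\<close>.
\<close>

lemma newton_step:
  fixes f g :: "('a :: field, 'n :: finite) mfps"
  assumes B: "B = {0} \<or> B = UNIV" and j: "mpow j \<subseteq> tangent B g"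
    and d: "f - g \<in> mpow (M + j)" and "0 < M"
  obtains \<phi> b where "mfps_alg_hom \<phi>" "\<And>h. \<phi> h - h \<in> mpow M" "b \<in> B" "b \<in> mpow M"
    "f - (1 + b) * \<phi> g \<in> mpow (2 * M)"
proof -
  obtain a b where ab: "b \<in> B" "b \<in> mpow M" "\<And>i. a i \<in> mpow M"
    "f - g = b * g + (\<Sum>i\<in>UNIV. a i * mfps_deriv i g)"
    using tangent_coeffs_mem_mpow[OF B j d] by blast
  have "mfps_X i + a i \<in> mpow 1" for i
    using \<open>0 < M\<close> ab(3) by (intro mpow_add mfps_X_mem_mpow) (rule mpow_antimono, auto)
  then obtain \<phi> where \<phi>: "mfps_alg_hom \<phi>" "\<And>i. \<phi> (mfps_X i) = mfps_X i + a i"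
    using ex_mfps_subst[of "\<lambda>i. mfps_X i + a i"] by metis
  interpret mfps_alg_hom \<phi> by fact
  have close: "\<phi> h - h \<in> mpow M" for h
    by (rule diff_id_mem_mpow) (simp add: \<phi>(2) ab(3))
  \<comment> \<open>Two errors remain, the Taylor remainder and \<open>b * (\<phi> g - g)\<close>;
    both have order \<open>2 * M\<close>.\<close>
  have "f - (1 + b) * \<phi> g = - (\<phi> g - g - (\<Sum>i\<in>UNIV. a i * mfps_deriv i g)) - b * (\<phi> g - g)"
    using ab(4) by (simp add: algebra_simps)
  also have "\<dots> \<in> mpow (2 * M)"
    using mpow_diff[OF mpow_uminus[OF taylor_mem_mpow[OF \<phi>(2) ab(3)]]
        mpow_mult[OF ab(2) close, folded mult_2]] .
  finally show thesis using that[OF \<phi>(1) close ab(1,2)] by blast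
qed

text \<open>The Newton steps are composed by dependent choice. \<open>P\<close> describes a stage,
  with an automorphism tangent to the identity and a unit; \<open>Q\<close> bounds the increments,
  so that both converge.\<close>

lemma mfps_equiv_if_close:
  fixes f g :: "('a :: field, 'n :: finite) mfps"
  assumes B: "B = {0} \<or> B = UNIV" and j: "mpow j \<subseteq> tangent B g" "0 < j"
    and close: "f - g \<in> mpow (2 * j + 1)"
  shows "mfps_equiv B f g"
proof -
  define P where "P s x \<longleftrightarrow> (case x of (\<Phi>, u) \<Rightarrow> mfps_alg_hom \<Phi> \<and> (\<forall>h. \<Phi> h - h \<in> mpow 2) \<and>
      u - 1 \<in> B \<and> u - 1 \<in> mpow 1 \<and> f - u * \<Phi> g \<in> mpow (2 * j + 1 + s))" for s x
  define Q where "Q s x y \<longleftrightarrow> (case (x, y) of ((\<Phi>, u), (\<Phi>', u')) \<Rightarrow>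
      (\<forall>h :: ('a, 'n) mfps. \<Phi>' h - \<Phi> h \<in> mpow (j + 1 + s)) \<and>
      u' - u \<in> mpow (j + 1 + s))"
    for s and x y :: "(('a, 'n) mfps \<Rightarrow> ('a, 'n) mfps) \<times> ('a, 'n) mfps"
  have unit: "u dvd 1" if "u - 1 \<in> mpow 1" for u :: "('a, 'n) mfps"
    using mfps_unit_one_minus[of "1 - u"] mpow_diff_sym[OF that] by simp
  have bij: "bij \<Phi>" if "mfps_alg_hom \<Phi>" "\<forall>h. \<Phi> h - h \<in> mpow 2"
    for \<Phi> :: "('a, 'n) mfps \<Rightarrow> ('a, 'n) mfps"
    using mfps_alg_hom.bij_if_tangent_to_id[OF that(1)] that(2) by blast
  have start: "P 0 (\<lambda>h. h, 1)"
    using close B by (auto simp: P_def mfps_alg_hom_id)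
  have step: "\<exists>y. P (Suc s) y \<and> Q s x y" if "P s x" for s x
  proof -
    obtain \<Phi> u where x: "x = (\<Phi>, u)" by (cases x)
    have \<Phi>: "mfps_alg_hom \<Phi>" "\<And>h. \<Phi> h - h \<in> mpow 2" and u: "u - 1 \<in> B" "u - 1 \<in> mpow 1"
      and d: "f - u * \<Phi> g \<in> mpow (2 * j + 1 + s)"
      using that unfolding P_def x by auto
    \<comment> \<open>The current order \<open>2 * j + 1 + s\<close> equals \<open>M + j\<close>.
      The step yields order \<open>2 * M\<close>, at least one more than before, and
      \<open>M \<ge> 2\<close> keeps the coordinate change tangent to the identity.\<close>
    define M where "M = j + 1 + s"
    have "mpow j \<subseteq> tangent B (u * \<Phi> g)"
      using \<Phi> u j(1) by (intro mpow_subset_tangent_transform B bij unit) auto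
    moreover have "M + j = 2 * j + 1 + s" by (simp add: M_def)
    then have "f - u * \<Phi> g \<in> mpow (M + j)" using d by (simp only:)
    ultimately obtain \<phi> b where \<phi>: "mfps_alg_hom \<phi>" "\<And>h. \<phi> h - h \<in> mpow M"
      and b: "b \<in> B" "b \<in> mpow M"
      and d': "f - (1 + b) * \<phi> (u * \<Phi> g) \<in> mpow (2 * M)"
      using newton_step[OF B, of j "u * \<Phi> g" f M] by (auto simp: M_def)
    interpret \<phi>: mfps_alg_hom \<phi> by fact
    define u' where "u' = (1 + b) * \<phi> u"
    have "(\<phi> u - u) + b * \<phi> u \<in> mpow M"
      using \<phi>(2) b(2) by (intro mpow_add mpow_mult2)
    then have u'_u: "u' - u \<in> mpow M"
      by (simp add: u'_def algebra_simps)
    have "u' - 1 \<in> mpow 1"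
      using mpow_antimono[OF u'_u, of 1] u(2) by (auto simp: M_def intro: mpow_diff_trans)
    moreover have "u' - 1 \<in> B" using B b(1) u(1) by (auto simp: u'_def)
    moreover have "\<phi> (\<Phi> h) - h \<in> mpow 2" for h
      using mpow_antimono[OF \<phi>(2), of 2] \<Phi>(2) j(2) by (auto simp: M_def intro: mpow_diff_trans)
    moreover have "f - u' * \<phi> (\<Phi> g) \<in> mpow (2 * j + 1 + Suc s)"
      by (rule mpow_antimono[of _ "2 * M"]) (use d' in \<open>auto simp: u'_def M_def mult.assoc\<close>)
    ultimately have "P (Suc s) (\<lambda>h. \<phi> (\<Phi> h), u')"
      using mfps_alg_hom_comp[OF \<phi>(1) \<Phi>(1)] by (simp add: P_def)
    moreover have "Q s x (\<lambda>h. \<phi> (\<Phi> h), u')"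
      using \<phi>(2) u'_u by (simp add: Q_def x M_def)
    ultimately show ?thesis by blast
  qed
  obtain F where F: "\<And>s. P s (F s) \<and> Q s (F s) (F (Suc s))"
    using dependent_nat_choice[of P Q] start step by metis
  define \<Phi> where "\<Phi> s = fst (F s)" for s
  define u where "u s = snd (F s)" for s
  have F_eq: "F s = (\<Phi> s, u s)" for s by (simp add: \<Phi>_def u_def)
  have \<Phi>: "mfps_alg_hom (\<Phi> s)" "\<Phi> s h - h \<in> mpow 2" "\<Phi> (Suc s) h - \<Phi> s h \<in> mpow (j + 1 + s)"
    and u: "u s - 1 \<in> B" "u s - 1 \<in> mpow 1" "u (Suc s) - u s \<in> mpow (j + 1 + s)"
    and d: "f - u s * \<Phi> s g \<in> mpow (2 * j + 1 + s)" for s h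
    using F[of s] by (auto simp: P_def Q_def F_eq)
  obtain \<phi> where \<phi>: "mfps_alg_hom \<phi>" "\<And>h s. \<phi> h - \<Phi> s h \<in> mpow (j + 1 + s)"
    using mfps_alg_hom_limit[of \<Phi> "j + 1"] \<Phi>(1,3) by metis
  obtain l where l: "\<And>s. l - u s \<in> mpow (j + 1 + s)"
    using mfps_limit[OF u(3)] by metis
  have "\<phi> h - h \<in> mpow 2" for h
    using mpow_antimono[OF \<phi>(2)[of h 0], of 2] \<Phi>(2) j(2) by (auto intro: mpow_diff_trans)
  then have "bij \<phi>" using bij \<phi>(1) by blast
  moreover have "l dvd 1"
    using mpow_antimono[OF l[of 0], of 1] u(2)[of 0] by (intro unit) (auto intro: mpow_diff_trans)
  moreover have "l - 1 \<in> B"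
  proof (cases "B = {0}")
    case True
    then have "u s = 1" for s using u(1)[of s] by simp
    then have "l = 1"
      using mpow_antimono[OF l] by (intro mfps_eqI_mpow) (metis le_add2)
    then show ?thesis using True by simp
  qed (use B in simp)
  moreover have "f = l * \<phi> g"
  proof (rule mfps_eqI_mpow)
    fix s
    have "l * \<phi> g - u s * \<Phi> s g \<in> mpow s"
      by (rule mpow_diff_mult) (rule mpow_antimono[OF l] mpow_antimono[OF \<phi>(2)], simp)+
    moreover have "f - u s * \<Phi> s g \<in> mpow s"
      using d by (rule mpow_antimono) simp
    ultimately show "f - l * \<phi> g \<in> mpow s"
      using mpow_diff_trans mpow_diff_sym by blast
  qed
  ultimately show ?thesis unfolding mfps_equiv_def using \<phi>(1) by blast
qed

text \<open>
  Modulo the derivatives of the polynomial \<open>g\<close> below, every polynomial reduces to one of degree less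
  than \<open>N - 1\<close> in each variable.
\<close>

lemma ex_close_isolated:
  fixes f :: "('a :: field, 'n :: finite) mfps"
  obtains g j where "f - g \<in> mpow (k + 1)" "mpow j \<subseteq> tangent {0} g"
proof -
  \<comment> \<open>The consecutive integers \<open>k + 2\<close> and \<open>k + 3\<close> cannot
    both vanish in the field, since they differ by 1.\<close>
  obtain N where N: "k + 2 \<le> N" "of_nat N \<noteq> (0 :: 'a)"
  proof (cases "of_nat (k + 2) = (0 :: 'a)")
    case True
    have "of_nat (Suc (k + 2)) = (1 :: 'a)" by (simp only: of_nat_Suc True add_0_right)
    then have "of_nat (Suc (k + 2)) \<noteq> (0 :: 'a)" by (metis one_neq_zero)
    from that[OF _ this] show ?thesis by simp
  qed (use that in blast)
  define p where "p = (\<Sum>a | mdeg a < k + 1. mfps_const (mfps_nth f a) * mfps_monom a)"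
  define g where "g = p + (\<Sum>i\<in>UNIV. mfps_monom (0(i := N)))"
  define I where "I = tangent {0} g"
  define S where "S = (mfps_monom :: _ \<Rightarrow> ('a, 'n) mfps) ` {m. \<forall>i. m i < N - 1}"
  have I: "ideal I mfps_ring" unfolding I_def by (simp add: ideal_tangent)
  have "f - g \<in> mpow (k + 1)"
  proof -
    have "f - p \<in> mpow (k + 1)"
      by (rule mpowI) (simp add: p_def mfps_nth_sum if_distrib[of "\<lambda>c. _ * c"] cong: if_cong)
    moreover have "mfps_monom (0(i := N)) \<in> mpow (k + 1)" for i
      using mfps_monom_mem_mpow[of "0(i := N)"] unfolding mdeg_single
      by (rule mpow_antimono) (use N(1) in simp)
    ultimately show ?thesis
      unfolding g_def diff_diff_add[symmetric] by (blast intro: mpow_diff[of "f - p"] mpow_sum)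
  qed
  have deriv_g: "mfps_deriv i g = mfps_deriv i p + mfps_const (of_nat N) * mfps_monom (0(i := N - 1))" for i
  proof -
    have "mfps_deriv i (mfps_monom (0(j := N)) :: ('a, 'n) mfps) =
        (if j = i then mfps_const (of_nat N) * mfps_monom (0(i := N - 1)) else 0)" for j
    proof -
      have "0(i := N) - 0(i := 1) = 0(i := N - 1)" by (auto simp: fun_eq_iff)
      then show ?thesis by (auto simp: mfps_deriv_monom mfps_const_simps)
    qed
    then show ?thesis by (simp add: g_def mfps_deriv_add mfps_deriv_sum)
  qed
  \<comment> \<open>Modulo \<open>I\<close>, \<open>of_nat N\<close> times the monomial
    \<open>m\<close> equals \<open>- mfps_monom b * mfps_deriv i p\<close>, whose terms have smaller
    degree because \<open>p\<close> has degree at most \<open>k < N - 1\<close>.\<close>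
  have monom: "mfps_monom m \<in> mfps.span (S \<union> I)" for m
  proof (induction "mdeg m" arbitrary: m rule: less_induct)
    case less
    show ?case
    proof (cases "\<forall>i. m i < N - 1")
      case True
      then show ?thesis by (auto simp: S_def intro: mfps.span_base)
    next
      case False
      then obtain i where i: "N - 1 \<le> m i" by (auto simp: not_less)
      define b where "b = m - 0(i := N - 1)"
      have m: "m = b + 0(i := N - 1)" using i by (auto simp: b_def fun_eq_iff)
      have "mfps_monom b * mfps_deriv i p = (\<Sum>a | mdeg a < k + 1.
          mfps_const (mfps_nth f a * of_nat (a i)) * mfps_monom (b + (a - 0(i := 1))))"
        unfolding p_def mfps_deriv_sum mfps_deriv_mult mfps_deriv_const mfps_deriv_monom
          sum_distrib_left
        by (simp only: mult_zero_left add_0_left mult.left_commute[of "mfps_monom b"]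
            mfps_monom_mult mult.assoc mfps_const_simps(4))
      moreover have "mfps_monom (b + (a - 0(i := 1))) \<in> mfps.span (S \<union> I)" if "mdeg a < k + 1" for a
      proof (rule less)
        have "mdeg (a - 0(i := 1)) \<le> mdeg a" unfolding mdeg_def by (intro sum_mono) simp
        moreover have "mdeg m = mdeg b + (N - 1)" using m by (metis mdeg_add mdeg_single)
        ultimately show "mdeg (b + (a - 0(i := 1))) < mdeg m"
          using that N(1) by (simp add: mdeg_add)
      qed
      ultimately have 1: "mfps_monom b * mfps_deriv i p \<in> mfps.span (S \<union> I)"
        by (auto intro!: mfps.span_sum mfps.span_scale)
      have "mfps_monom b * mfps_deriv i g \<in> I"
        unfolding I_def by (intro ideal_type_mult ideal_tangent deriv_mem_tangent) auto
      then have "mfps_monom b * mfps_deriv i g \<in> mfps.span (S \<union> I)"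
        by (auto intro: mfps.span_base)
      from mfps.span_diff[OF this 1]
      have "mfps_monom b * (mfps_const (of_nat N) * mfps_monom (0(i := N - 1))) \<in> mfps.span (S \<union> I)"
        unfolding deriv_g distrib_left add_diff_cancel_left' .
      also have "mfps_monom b * (mfps_const (of_nat N) * mfps_monom (0(i := N - 1))) =
          mfps_const (of_nat N) * mfps_monom m"
        unfolding mult.left_commute[of "mfps_monom b"] mfps_monom_mult m[symmetric] ..
      finally have "mfps_const (of_nat N) * mfps_monom m \<in> mfps.span (S \<union> I)" .
      from mfps.span_scale[OF this, of "inverse (of_nat N)"] show ?thesis
        using N(2) by simp
    qed
  qed
  have "{m :: 'n \<Rightarrow> nat. \<forall>i. m i < N - 1} \<subseteq> {m. m \<le> (\<lambda>_. N)}"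
  proof (safe, rule le_funI)
    fix m :: "'n \<Rightarrow> nat" and i
    assume "\<forall>i. m i < N - 1"
    then have "m i < N - 1" by blast
    then show "m i \<le> N" by simp
  qed
  from finite_subset[OF this finite_exponents_le] have "finite S"
    unfolding S_def by (rule finite_imageI)
  then obtain j where "mpow j \<subseteq> I"
    using mpow_subset_if_powers_in_span[OF I, of S] monom by blast
  then show thesis using that \<open>f - g \<in> mpow (k + 1)\<close> unfolding I_def by blast
qed

text \<open>Both claims of the theorem are instances, with \<open>B = {0}\<close> and
  \<open>B = UNIV\<close>.\<close>

lemma finitely_determined_iff:
  fixes f :: "('a :: field, 'n :: finite) mfps"
  assumes B: "B = {0} \<or> B = UNIV"
  shows "(\<exists>j. mpow j \<subseteq> tangent B f) \<longleftrightarrow>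
    (\<exists>k>0. \<forall>g. f - g \<in> mpow (k + 1) \<longrightarrow> mfps_equiv B f g)"
proof
  assume "\<exists>j. mpow j \<subseteq> tangent B f"
  then obtain j where "mpow j \<subseteq> tangent B f" by blast
  \<comment> \<open>The successor provides the positive exponent that
    \<open>mfps_equiv_if_close\<close> requires.\<close>
  then have j: "mpow (Suc j) \<subseteq> tangent B f" using mpow_antimono[of _ "Suc j" j] by auto
  have "mfps_equiv B f g" if "f - g \<in> mpow (2 * Suc j + 1)" for g
    \<comment> \<open>\<open>mfps_equiv_if_close\<close> puts the tangent condition on its second
      argument, so it is applied with \<open>f\<close> and \<open>g\<close> exchanged.\<close>
    by (rule mfps_equiv_sym[OF B], rule mfps_equiv_if_close[OF B j _ mpow_diff_sym[OF that]]) simp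
  then show "\<exists>k>0. \<forall>g. f - g \<in> mpow (k + 1) \<longrightarrow> mfps_equiv B f g"
    by (intro exI[of _ "2 * Suc j"]) auto
next
  assume "\<exists>k>0. \<forall>g. f - g \<in> mpow (k + 1) \<longrightarrow> mfps_equiv B f g"
  then obtain k where k: "\<And>g. f - g \<in> mpow (k + 1) \<Longrightarrow> mfps_equiv B f g" by blast
  obtain g j where g: "f - g \<in> mpow (k + 1)" "mpow j \<subseteq> tangent {0} g"
    by (rule ex_close_isolated)
  obtain \<phi> u where \<phi>: "mfps_alg_hom \<phi>" "bij \<phi>" and u: "u dvd 1" "u - 1 \<in> B" and f: "f = u * \<phi> g"
    using k[OF g(1)] unfolding mfps_equiv_def by blast
  \<comment> \<open>A series that is isolated in the Milnor sense is so in the Tjurina sense, so one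
    choice of \<open>g\<close> serves both cases.\<close>
  have "tangent {0} g \<subseteq> tangent B g"
    using B by (intro tangent_subset_ideal ideal_tangent deriv_mem_tangent self_mem_tangent) auto
  with g(2) have "mpow j \<subseteq> tangent B g" by blast
  then have "mpow j \<subseteq> tangent B f"
    unfolding f by (rule mpow_subset_tangent_transform[OF B \<phi> u])
  then show "\<exists>j. mpow j \<subseteq> tangent B f" by blast
qed

theorem theorem2p8:
  fixes f :: "('k :: alg_closed_field, 'n :: finite) mfps"
  assumes "f \<noteq> 0" and "f \<in> mfps_max_ideal"
  shows "(milnor_number f < \<infinity> \<longleftrightarrow> finitely_right_determined f) \<and>
    (tjurina_number f < \<infinity> \<longleftrightarrow> finitely_contact_determined f)"
  unfolding milnor_number_finite_iff tjurina_number_finite_iff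
    finitely_right_determined_def right_determined_def right_equivalent_iff
    finitely_contact_determined_def contact_determined_def contact_equivalent_iff mfps_max_ideal_pow
  by (intro conjI finitely_determined_iff) simp_all

end
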